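(* Let $f$ be a (target) probability density and $q_0$ a (safe) probability density on $\mathbb{R}^d$, let $K:\mathbb{R}^d\to[0,\infty)$ be a kernel, and let $(X_k)_{k\ge1}$, $(q_k)_{k\ge0}$, $(f_k)_{k\ge1}$ be generated by the safe and regularized adaptive importance sampling scheme described in the context, with mixture weights $(\lambda_k)_{k\ge1}$, bandwidths $(h_k)_{k\ge1}$ and regularization parameters $(\eta_k)_{k\ge1}$. Assume: (1) $(\lambda_k)_{k\ge1}$ is valued in $(0,1]$, nonincreasing, $\lim_{k\to\infty}\lambda_k=0$ and $\lim_{k\to\infty}\log(k)/(k\lambda_k)=0$; $(h_k)_{k\ge1}$ is valued in $(0,\infty)$, nonincreasing, $\lim_{k\to\infty}h_k=0$ and $\lim_{k\to\infty}\log(k)/(k h_k^d\lambda_k)=0$; $(\eta_k)_{k\ge1}$ is valued in $(0,1]$, $\lim_{k\to\infty}\eta_k=1$, $\lim_{k\to\infty}(1-\eta_k)\log(h_k)=0$ and $\lim_{k\to\infty}(1-\eta_k)\log(\lambda_{k-1})=0$. (2) $q_0$ is bounded and there exists $c>0$ such that $q_0(x)\ge c f(x)$ for all $x\in\mathbb{R}^d$. (3) $f$ is nonnegative, $L$-Lipschitz for some $L$, and bounded by some constant $U$. (4) $\int K=1$, $\int\|u\|K(u)\,du<\infty$, $\int K^{1/2}<\infty$, $\int\|u\|K(u)^{1/2}\,du<\infty$; $K$ is bounded by some $K_\infty\ge0$, and $K$ is $L_K$-Lipschitz for some $L_K>0$, i.e. $|K(x+u)-K(x)|\le L_K\|u\|$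 for all $x,u\in\mathbb{R}^d$. Then, for any $r>0$, almost surely, $$\sup_{\|x\|\le n^r}|f_n(x)-f(x)|\to 0\quad\text{as } n\to\infty.$$
   Context: Densities are with respect to Lebesgue measure on $\mathbb{R}^d$. For $h>0$, $K_h(u)=K(u/h)/h^d$. Safe and regularized adaptive importance sampling: let $(X_k)_{k\ge1}$ be random variables on a probability space, $\mathcal F_k=\sigma(X_1,\dots,X_k)$ and $\mathcal F_0$ trivial. For every $k\ge1$, conditionally on $\mathcal F_{k-1}$, $X_k$ has density $q_{k-1}$, where $q_0$ is the given density and, for $n\ge1$, $$q_n=(1-\lambda_n)f_n+\lambda_n q_0,\qquad f_n(x)=\sum_{k=1}^n W_{n,k}^{(\eta_k)}K_{h_n}(x-X_k),\qquad W_{n,k}^{(\eta_k)}=\frac{W_k^{\eta_k}}{\sum_{j=1}^n W_j^{\eta_j}},\qquad W_k=\frac{f(X_k)}{q_{k-1}(X_k)}.$$ The weights are normalized to sum to $1$; it is implicit that $\sum_{j=1}^n W_j^{\eta_j}>0$ almost surely for every $n\ge1$. *)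

theory Defs
  imports "HOL-Probability.Probability"
begin

definition prob_density :: "('a::euclidean_space \<Rightarrow> real) \<Rightarrow> bool" where
  "prob_density g \<longleftrightarrow>
     g \<in> borel_measurable borel \<and> (\<forall>x. 0 \<le> g x) \<and> (\<integral>\<^sup>+x. ennreal (g x) \<partial>lborel) = 1"

definition scaled_kernel :: "('a::euclidean_space \<Rightarrow> real) \<Rightarrow> real \<Rightarrow> 'a \<Rightarrow> real" where
  "scaled_kernel K b u = K (u /\<^sub>R b) / b ^ DIM('a)"

text \<open>
  Samples are indexed from 1; the value at index 0 of a sample path, of the unnormalized weights
  and of the parameter sequences is not used in the scheme.
\<close>

definition normalized_weight :: "(nat \<Rightarrow> real) \<Rightarrow> (nat \<Rightarrow> real) \<Rightarrow> nat \<Rightarrow> nat \<Rightarrow> real" where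
  "normalized_weight eta W n k = W k powr eta k / (\<Sum>j=1..n. W j powr eta j)"

definition weighted_kde ::
  "('a::euclidean_space \<Rightarrow> real) \<Rightarrow> (nat \<Rightarrow> real) \<Rightarrow> (nat \<Rightarrow> real) \<Rightarrow> (nat \<Rightarrow> real)
    \<Rightarrow> (nat \<Rightarrow> 'a) \<Rightarrow> nat \<Rightarrow> 'a \<Rightarrow> real" where
  "weighted_kde K h eta W x n y =
     (\<Sum>k=1..n. normalized_weight eta W n k * scaled_kernel K (h n) (y - x k))"

lemma weighted_kde_cong [fundef_cong]:
  assumes "K = K'" "h = h'" "eta = eta'" "x = x'" "n = n'" "y = y'"
    and "\<And>k. k \<in> {1..n'} \<Longrightarrow> W k = W' k"
  shows "weighted_kde K h eta W x n y = weighted_kde K' h' eta' W' x' n' y'"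
  using assms unfolding weighted_kde_def normalized_weight_def
  by (auto intro!: sum.cong simp: assms(7) cong: sum.cong)

text \<open>
  For a realized sample path \<open>x 1, x 2, \<dots>\<close>, \<open>ais_policy \<dots> x n\<close> is the sampling density \<open>q\<^sub>n\<close>. It is
  defined by recursion on \<open>n\<close>, as the weight of \<open>x k\<close> involves the earlier density \<open>q\<^sub>k\<^sub>-\<^sub>1\<close>.
\<close>

function ais_policy ::
  "('a::euclidean_space \<Rightarrow> real) \<Rightarrow> ('a \<Rightarrow> real) \<Rightarrow> ('a \<Rightarrow> real) \<Rightarrow> (nat \<Rightarrow> real) \<Rightarrow> (nat \<Rightarrow> real)
    \<Rightarrow> (nat \<Rightarrow> real) \<Rightarrow> (nat \<Rightarrow> 'a) \<Rightarrow> nat \<Rightarrow> 'a \<Rightarrow> real" where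
  "ais_policy K f q0 lam h eta x n y =
     (if n = 0 then q0 y
      else (1 - lam n) * weighted_kde K h eta
               (\<lambda>k. f (x k) / ais_policy K f q0 lam h eta x (k - 1) (x k)) x n y
             + lam n * q0 y)"
  by pat_completeness auto
termination
  by (relation "Wellfounded.measure (\<lambda>(K, f, q0, lam, h, eta, x, n, y). n)") auto

declare ais_policy.simps [simp del]

definition ais_weight ::
  "('a::euclidean_space \<Rightarrow> real) \<Rightarrow> ('a \<Rightarrow> real) \<Rightarrow> ('a \<Rightarrow> real) \<Rightarrow> (nat \<Rightarrow> real) \<Rightarrow> (nat \<Rightarrow> real)
    \<Rightarrow> (nat \<Rightarrow> real) \<Rightarrow> (nat \<Rightarrow> 'a) \<Rightarrow> nat \<Rightarrow> real" where
  "ais_weight K f q0 lam h eta x k = f (x k) / ais_policy K f q0 lam h eta x (k - 1) (x k)"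

definition ais_estimate ::
  "('a::euclidean_space \<Rightarrow> real) \<Rightarrow> ('a \<Rightarrow> real) \<Rightarrow> ('a \<Rightarrow> real) \<Rightarrow> (nat \<Rightarrow> real) \<Rightarrow> (nat \<Rightarrow> real)
    \<Rightarrow> (nat \<Rightarrow> real) \<Rightarrow> (nat \<Rightarrow> 'a) \<Rightarrow> nat \<Rightarrow> 'a \<Rightarrow> real" where
  "ais_estimate K f q0 lam h eta x n y =
     weighted_kde K h eta (ais_weight K f q0 lam h eta x) x n y"

lemma ais_policy_0: "ais_policy K f q0 lam h eta x 0 = q0"
  by (rule ext) (subst ais_policy.simps, simp)

lemma ais_policy_mixture:
  assumes "n \<ge> 1"
  shows "ais_policy K f q0 lam h eta x n y
           = (1 - lam n) * ais_estimate K f q0 lam h eta x n y + lam n * q0 y"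
  using assms
  by (subst ais_policy.simps) (simp add: ais_estimate_def ais_weight_def[abs_def])

definition sample_history :: "'b measure \<Rightarrow> (nat \<Rightarrow> 'b \<Rightarrow> 'a::euclidean_space) \<Rightarrow> nat \<Rightarrow> 'b measure" where
  "sample_history M X n =
     sigma (space M) (\<Union>k\<in>{1..n}. {X k -` B \<inter> space M |B. B \<in> sets borel})"

definition has_cond_density ::
  "'b measure \<Rightarrow> 'b measure \<Rightarrow> ('b \<Rightarrow> 'a::euclidean_space) \<Rightarrow> ('b \<Rightarrow> 'a \<Rightarrow> real) \<Rightarrow> bool" where
  "has_cond_density M F Y g \<longleftrightarrow>
     (\<forall>B\<in>sets borel. AE \<omega> in M.
        nn_cond_exp M F (\<lambda>\<omega>'. indicator B (Y \<omega>')) \<omega> = (\<integral>\<^sup>+y\<in>B. ennreal (g \<omega> y) \<partial>lborel))"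

end

theory Submission
  imports Defs
begin

text \<open>
  Write \<open>f\<^sub>n = N\<^sub>n / S\<^sub>n\<close>, where \<open>N\<^sub>n(x)\<close> and \<open>S\<^sub>n\<close> are the averages over \<open>k \<le> n\<close> of
  \<open>W\<^sub>k powr \<eta>\<^sub>k * \<phi>(X\<^sub>k)\<close> for \<open>\<phi> = K\<^sub>h(x - _)\<close> and for \<open>\<phi> = 1\<close>. Given the past, such a summand
  has mean \<open>\<integral> f powr \<eta>\<^sub>k * q powr (1 - \<eta>\<^sub>k) * \<phi>\<close> with \<open>q\<close> the sampling density of \<open>X\<^sub>k\<close>. As \<open>q\<close> lies
  between a multiple of \<open>\<lambda> f\<close> (by the mixture with \<open>q\<^sub>0\<close>) and a multiple of \<open>1 / h ^ d\<close> (by the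
  bound on the kernel), the conditions on \<open>\<eta>\<close> bring this mean close to \<open>\<integral> f * \<phi>\<close>, with an error
  that is deterministic. The summands are nonnegative and of order at most \<open>1 / (\<lambda>\<^sub>n h\<^sub>n ^ d)\<close>, so a
  bounded mean also controls the conditional second moment, and a Chernoff argument gives deviation
  probabilities \<open>exp (- \<delta> n \<lambda>\<^sub>n h\<^sub>n ^ d)\<close>, which beat every power of \<open>n\<close>. A union bound over a grid of
  mesh \<open>1 / n ^ 3\<close>, the Borel-Cantelli lemma and the Lipschitz continuity of \<open>K\<close> and \<open>f\<close> conclude.
\<close>

subsection \<open>Conditional densities along the sample path\<close>

text \<open>The conditional density is given set by set, each time up to a null set, whereas
  integrands below depend jointly on the past and the sample. The two sides integrate against
  measures on the product space that agree on rectangles, an intersection-stable generator, and the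
  first has mass one, so the measures coincide.\<close>

lemma nn_integral_cond_density:
  assumes "prob_space M" and sub: "subalgebra M F"
    and Y [measurable]: "Y \<in> borel_measurable M"
    and dens: "has_cond_density M F Y g"
    and g [measurable]: "(\<lambda>(\<omega>, y). g \<omega> y) \<in> borel_measurable (F \<Otimes>\<^sub>M lborel)"
    and \<Phi> [measurable]: "(\<lambda>(\<omega>, y). \<Phi> \<omega> y) \<in> borel_measurable (F \<Otimes>\<^sub>M lborel)"
  shows "(\<integral>\<^sup>+\<omega>. \<Phi> \<omega> (Y \<omega>) \<partial>M) = (\<integral>\<^sup>+\<omega>. (\<integral>\<^sup>+y. \<Phi> \<omega> y * ennreal (g \<omega> y) \<partial>lborel) \<partial>M)"
proof -
  interpret prob_space M by fact
  interpret finite_measure_subalgebra M F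
    by unfold_locales (fact sub)
  \<comment> \<open>\<open>F\<close> comes without a meaningful measure; \<open>MF\<close> equips
    its sigma-algebra with the restriction of \<open>M\<close>, so that Tonelli's theorem applies to
    the product with \<open>lborel\<close>.\<close>
  define MF where "MF = restr_to_subalg M F"
  have sets_MF [measurable_cong]: "sets MF = sets F"
    unfolding MF_def by (rule sets_restr_to_subalg[OF sub])
  have idF: "(\<lambda>\<omega>. \<omega>) \<in> measurable M F"
    using sub by (auto simp: subalgebra_def measurable_def sets.sets_into_space)
  have pairY [measurable]: "(\<lambda>\<omega>. (\<omega>, Y \<omega>)) \<in> measurable M (F \<Otimes>\<^sub>M lborel)"
    using idF by (intro measurable_Pair) auto
  have restr: "(\<integral>\<^sup>+\<omega>. u \<omega> \<partial>MF) = (\<integral>\<^sup>+\<omega>. u \<omega> \<partial>M)" if "u \<in> borel_measurable F" for u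
    unfolding MF_def using sub that by (rule nn_integral_subalgebra2)
  define \<mu>1 where "\<mu>1 = distr M (F \<Otimes>\<^sub>M lborel) (\<lambda>\<omega>. (\<omega>, Y \<omega>))"
  define \<mu>2 where "\<mu>2 = density (MF \<Otimes>\<^sub>M lborel) (\<lambda>(\<omega>, y). ennreal (g \<omega> y))"
  have sets2: "sets (MF \<Otimes>\<^sub>M (lborel :: 'b measure)) = sets (F \<Otimes>\<^sub>M (lborel :: 'b measure))"
    by (intro sets_pair_measure_cong sets_MF refl)
  have "\<mu>1 = \<mu>2"
  proof (rule measure_eqI_generator_eq[OF Int_stable_pair_measure_generator[of F lborel],
        where \<Omega> = "space F \<times> space (lborel :: 'b measure)"
          and A = "\<lambda>_. space F \<times> space (lborel :: 'b measure)"])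
    show "{a \<times> b |a b. a \<in> sets F \<and> b \<in> sets lborel} \<subseteq> Pow (space F \<times> space (lborel :: 'b measure))"
      by (rule pair_measure_closed)
  next
    fix S assume "S \<in> {a \<times> b |a b. a \<in> sets F \<and> b \<in> sets (lborel :: 'b measure)}"
    then obtain A B where S: "S = A \<times> B" and A [measurable]: "A \<in> sets F" and B: "B \<in> sets (lborel :: 'b measure)"
      by blast
    have B' [measurable]: "B \<in> sets borel" using B by simp
    have AM [measurable]: "A \<in> sets M" using A sub by (auto simp: subalgebra_def)
    have SF: "S \<in> sets (F \<Otimes>\<^sub>M lborel)" unfolding S using A B by simp
    have "emeasure \<mu>1 S = (\<integral>\<^sup>+z. indicator S z \<partial>\<mu>1)"
      using SF by (simp add: \<mu>1_def)
    also have "\<dots> = (\<integral>\<^sup>+\<omega>. indicator A \<omega> * indicator B (Y \<omega>) \<partial>M)"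
      unfolding \<mu>1_def S using A B
      by (subst nn_integral_distr) (auto simp: indicator_times)
    also have "\<dots> = (\<integral>\<^sup>+\<omega>. indicator A \<omega> * nn_cond_exp M F (\<lambda>\<omega>'. indicator B (Y \<omega>')) \<omega> \<partial>M)"
      by (rule nn_cond_exp_intg[symmetric]) auto
    also have "\<dots> = (\<integral>\<^sup>+\<omega>. indicator A \<omega> * (\<integral>\<^sup>+y\<in>B. ennreal (g \<omega> y) \<partial>lborel) \<partial>M)"
    proof (rule nn_integral_cong_AE)
      have "AE \<omega> in M. nn_cond_exp M F (\<lambda>\<omega>'. indicator B (Y \<omega>')) \<omega>
          = (\<integral>\<^sup>+y\<in>B. ennreal (g \<omega> y) \<partial>lborel)"
        using dens B' unfolding has_cond_density_def by blast
      then show "AE \<omega> in M. indicator A \<omega> * nn_cond_exp M F (\<lambda>\<omega>'. indicator B (Y \<omega>')) \<omega>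
          = indicator A \<omega> * (\<integral>\<^sup>+y\<in>B. ennreal (g \<omega> y) \<partial>lborel)"
        by eventually_elim simp
    qed
    also have "\<dots> = (\<integral>\<^sup>+\<omega>. indicator A \<omega> * (\<integral>\<^sup>+y\<in>B. ennreal (g \<omega> y) \<partial>lborel) \<partial>MF)"
      by (rule restr[symmetric]) measurable
    also have "\<dots> = (\<integral>\<^sup>+\<omega>. (\<integral>\<^sup>+y. indicator S (\<omega>, y) * ennreal (g \<omega> y) \<partial>lborel) \<partial>MF)"
      by (intro nn_integral_cong)
        (simp add: S indicator_times mult.commute split: split_indicator)
    also have "\<dots> = (\<integral>\<^sup>+z. indicator S z * (case z of (\<omega>, y) \<Rightarrow> ennreal (g \<omega> y)) \<partial>(MF \<Otimes>\<^sub>M lborel))"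
    proof -
      have "(\<lambda>z. indicator S z * (case z of (\<omega>, y) \<Rightarrow> ennreal (g \<omega> y))) \<in> borel_measurable (MF \<Otimes>\<^sub>M lborel)"
        using SF unfolding measurable_cong_sets[OF sets2 refl] by measurable
      from lborel.nn_integral_fst[OF this] show ?thesis by simp
    qed
    also have "\<dots> = emeasure \<mu>2 S"
      unfolding \<mu>2_def using SF sets2
      by (subst emeasure_density) (auto simp: measurable_cong_sets[OF sets2 refl] mult.commute)
    finally show "emeasure \<mu>1 S = emeasure \<mu>2 S" .
  next
    show "sets \<mu>1 = sigma_sets (space F \<times> space (lborel :: 'b measure)) {a \<times> b |a b. a \<in> sets F \<and> b \<in> sets lborel}"
      unfolding \<mu>1_def by (simp add: sets_pair_measure)
    show "sets \<mu>2 = sigma_sets (space F \<times> space (lborel :: 'b measure)) {a \<times> b |a b. a \<in> sets F \<and> b \<in> sets lborel}"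
      unfolding \<mu>2_def using sets2 by (simp add: sets_pair_measure)
    have "prob_space \<mu>1" unfolding \<mu>1_def by (rule prob_space_distr) measurable
    then interpret p1: prob_space \<mu>1 .
    show "emeasure \<mu>1 (space F \<times> space (lborel :: 'b measure)) \<noteq> \<infinity>" for i :: nat
      by simp
    show "range (\<lambda>_::nat. space F \<times> space (lborel :: 'b measure)) \<subseteq> {a \<times> b |a b. a \<in> sets F \<and> b \<in> sets lborel}"
      by blast
  qed auto
  have "(\<integral>\<^sup>+\<omega>. \<Phi> \<omega> (Y \<omega>) \<partial>M) = (\<integral>\<^sup>+z. (case z of (\<omega>, y) \<Rightarrow> \<Phi> \<omega> y) \<partial>\<mu>1)"
    unfolding \<mu>1_def by (subst nn_integral_distr) auto
  also have "\<dots> = (\<integral>\<^sup>+z. (case z of (\<omega>, y) \<Rightarrow> ennreal (g \<omega> y)) * (case z of (\<omega>, y) \<Rightarrow> \<Phi> \<omega> y) \<partial>(MF \<Otimes>\<^sub>M lborel))"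
    unfolding \<open>\<mu>1 = \<mu>2\<close> \<mu>2_def
    by (rule nn_integral_density) (simp_all add: measurable_cong_sets[OF sets2 refl])
  also have "\<dots> = (\<integral>\<^sup>+z. (case z of (\<omega>, y) \<Rightarrow> \<Phi> \<omega> y * ennreal (g \<omega> y)) \<partial>(MF \<Otimes>\<^sub>M lborel))"
    by (intro nn_integral_cong) (auto simp: mult.commute)
  also have "\<dots> = (\<integral>\<^sup>+\<omega>. (\<integral>\<^sup>+y. \<Phi> \<omega> y * ennreal (g \<omega> y) \<partial>lborel) \<partial>MF)"
  proof -
    have "(\<lambda>z. (case z of (\<omega>, y) \<Rightarrow> \<Phi> \<omega> y * ennreal (g \<omega> y))) \<in> borel_measurable (MF \<Otimes>\<^sub>M lborel)"
      unfolding measurable_cong_sets[OF sets2 refl] by measurable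
    from lborel.nn_integral_fst[OF this] show ?thesis by simp
  qed
  also have "\<dots> = (\<integral>\<^sup>+\<omega>. (\<integral>\<^sup>+y. \<Phi> \<omega> y * ennreal (g \<omega> y) \<partial>lborel) \<partial>M)"
    by (rule restr) measurable
  finally show ?thesis .
qed

section \<open>Measurability with respect to the sample history\<close>

lemma sets_sample_history:
  "sets (sample_history M X n) =
     sigma_sets (space M) (\<Union>k\<in>{1..n}. {X k -` B \<inter> space M |B. B \<in> sets borel})"
  unfolding sample_history_def by (rule sets_measure_of) auto

lemma space_sample_history [simp]: "space (sample_history M X n) = space M"
  unfolding sample_history_def by (rule space_measure_of) auto

lemma subalgebra_sample_history:
  assumes "\<And>k. k \<ge> 1 \<Longrightarrow> X k \<in> borel_measurable M"
  shows "subalgebra M (sample_history M X n)"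
proof -
  have "(\<Union>k\<in>{1..n}. {X k -` B \<inter> space M |B. B \<in> sets borel}) \<subseteq> sets M"
    using assms by (auto simp: measurable_def)
  then show ?thesis
    unfolding subalgebra_def sets_sample_history
    by (simp add: sets.sigma_sets_subset)
qed

lemma measurable_sample_history:
  assumes "1 \<le> k" "k \<le> n"
  shows "(X k :: _ \<Rightarrow> 'b::euclidean_space) \<in> borel_measurable (sample_history M X n)"
proof (rule measurableI)
  fix B :: "'b set" assume "B \<in> sets borel"
  then show "X k -` B \<inter> space (sample_history M X n) \<in> sets (sample_history M X n)"
    unfolding sets_sample_history space_sample_history
    using assms by (intro sigma_sets.Basic UN_I[of k]) auto
qed simp

lemma sample_history_mono:
  assumes "m \<le> n"
  shows "sets (sample_history M X m) \<subseteq> sets (sample_history M X n)"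
  unfolding sets_sample_history using assms by (intro sigma_sets_mono') force

lemma measurable_sample_history_mono:
  assumes "m \<le> n" "u \<in> measurable (sample_history M X m) N"
  shows "u \<in> measurable (sample_history M X n) N"
  using assms(2) measurable_mono[OF order_refl refl sample_history_mono[OF assms(1)]] by auto

text \<open>Pairing the past with the next sample allows a jointly measurable function to be
  evaluated at that random point.\<close>

lemma measurable_sample_pair:
  assumes "1 \<le> k" "k \<le> n"
  shows "(\<lambda>\<omega>. (\<omega>, X k \<omega>)) \<in> measurable (sample_history M X n) (sample_history M X (k - 1) \<Otimes>\<^sub>M lborel)"
proof (rule measurable_Pair)
  show "(\<lambda>\<omega>. \<omega>) \<in> measurable (sample_history M X n) (sample_history M X (k - 1))"
    using assms by (intro measurable_sample_history_mono[of "k - 1" n]) (auto intro: measurable_ident_sets)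
  show "X k \<in> measurable (sample_history M X n) lborel"
    using measurable_sample_history[of k n X M] assms by simp
qed

lemma measurable_sample_compose:
  assumes "1 \<le> k" "k \<le> n"
    and "(\<lambda>(\<omega>, y). u \<omega> y) \<in> measurable (sample_history M X (k - 1) \<Otimes>\<^sub>M lborel) N"
  shows "(\<lambda>\<omega>. u \<omega> (X k \<omega>)) \<in> measurable (sample_history M X n) N"
  using measurable_compose[OF measurable_sample_pair[OF assms(1,2)] assms(3)] by simp

text \<open>Strong induction: the weight of \<open>X k\<close> evaluates the policy of index
  \<open>k - 1\<close> at the random point \<open>X k\<close>, so joint measurability in path and
  point has to be carried along.\<close>

lemma measurable_ais_policy:
  fixes K f q0 :: "'a::euclidean_space \<Rightarrow> real"
  assumes [measurable]: "K \<in> borel_measurable borel" "f \<in> borel_measurable borel" "q0 \<in> borel_measurable borel"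
  shows "(\<lambda>(\<omega>, y). ais_policy K f q0 lam h eta (\<lambda>i. X i \<omega>) n y)
    \<in> borel_measurable (sample_history M X n \<Otimes>\<^sub>M lborel)"
proof (induction n rule: less_induct)
  case (less n)
  show ?case
  proof (cases "n = 0")
    case True
    then show ?thesis by (simp add: ais_policy_0)
  next
    case False
    let ?H = "sample_history M X"
    have X: "(\<lambda>\<omega>. X k \<omega>) \<in> borel_measurable (?H n)" if "k \<in> {1..n}" for k
      using measurable_sample_history[of k n X M] that by simp
    have W [measurable]: "(\<lambda>\<omega>. ais_weight K f q0 lam h eta (\<lambda>i. X i \<omega>) k) \<in> borel_measurable (?H n)"
      if k: "k \<in> {1..n}" for k
    proof -
      note [measurable] = X[OF k]
      have "(\<lambda>\<omega>. ais_policy K f q0 lam h eta (\<lambda>i. X i \<omega>) (k - 1) (X k \<omega>)) \<in> borel_measurable (?H n)"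
        using k less.IH[of "k - 1"] by (intro measurable_sample_compose) auto
      then show ?thesis unfolding ais_weight_def by measurable
    qed
    \<comment> \<open>The recursion is unfolded once, which leaves only samples and weights already
      known to be measurable.\<close>
    have pol: "(\<lambda>(\<omega>, y). ais_policy K f q0 lam h eta (\<lambda>i. X i \<omega>) n y) = (\<lambda>(\<omega>, y).
       (1 - lam n) * (\<Sum>k=1..n. ais_weight K f q0 lam h eta (\<lambda>i. X i \<omega>) k powr eta k
         / (\<Sum>j=1..n. ais_weight K f q0 lam h eta (\<lambda>i. X i \<omega>) j powr eta j) *
          (K ((y - X k \<omega>) /\<^sub>R h n) / h n ^ DIM('a))) + lam n * q0 y)"
      using False by (intro ext) (simp add: ais_policy_mixture ais_estimate_def weighted_kde_def normalized_weight_def scaled_kernel_def)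
    show ?thesis unfolding pol split_beta'
      using X
      by (intro borel_measurable_add borel_measurable_times borel_measurable_sum borel_measurable_divide
           borel_measurable_const powr_real_measurable measurable_compose[OF measurable_fst W]
           measurable_compose[OF _ assms(1)] measurable_compose[OF _ assms(3)]
           borel_measurable_scaleR borel_measurable_diff
           measurable_compose[OF measurable_fst X]) auto
  qed
qed

lemma measurable_ais_weight:
  fixes K f q0 :: "'a::euclidean_space \<Rightarrow> real"
  assumes [measurable]: "K \<in> borel_measurable borel" "f \<in> borel_measurable borel" "q0 \<in> borel_measurable borel"
    and k: "1 \<le> k" "k \<le> n"
  shows "(\<lambda>\<omega>. ais_weight K f q0 lam h eta (\<lambda>i. X i \<omega>) k) \<in> borel_measurable (sample_history M X n)"
proof -
  note [measurable] = measurable_sample_history[of k n X M, OF k]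
  have "(\<lambda>\<omega>. ais_policy K f q0 lam h eta (\<lambda>i. X i \<omega>) (k - 1) (X k \<omega>)) \<in> borel_measurable (sample_history M X n)"
    using k by (intro measurable_sample_compose measurable_ais_policy assms)
  then show ?thesis unfolding ais_weight_def by measurable
qed

text \<open>This is used to multiply conditional exponential moments along the path. The last factor
  is integrated first, given the past; since its bound \<open>\<kappa>\<close> is deterministic, it
  leaves the integral and the induction continues with the remaining factors.\<close>

lemma nn_integral_prod_samples_le:
  fixes X :: "nat \<Rightarrow> 'b \<Rightarrow> 'a::euclidean_space"
  assumes M: "prob_space M" and X: "\<And>k. k \<ge> 1 \<Longrightarrow> X k \<in> borel_measurable M"
    and dens: "\<And>k. k \<ge> 1 \<Longrightarrow> has_cond_density M (sample_history M X (k - 1)) (X k) (q k)"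
    and q: "\<And>k. k \<ge> 1 \<Longrightarrow> (\<lambda>(\<omega>, y). q k \<omega> y) \<in> borel_measurable (sample_history M X (k - 1) \<Otimes>\<^sub>M lborel)"
    and \<Phi>: "\<And>k. k \<ge> 1 \<Longrightarrow> (\<lambda>(\<omega>, y). \<Phi> k \<omega> y) \<in> borel_measurable (sample_history M X (k - 1) \<Otimes>\<^sub>M lborel)"
    and le: "\<And>k \<omega>. 1 \<le> k \<Longrightarrow> k \<le> n \<Longrightarrow> \<omega> \<in> space M \<Longrightarrow> (\<integral>\<^sup>+y. \<Phi> k \<omega> y * ennreal (q k \<omega> y) \<partial>lborel) \<le> \<kappa> k"
  shows "(\<integral>\<^sup>+\<omega>. (\<Prod>k=1..n. \<Phi> k \<omega> (X k \<omega>)) \<partial>M) \<le> (\<Prod>k=1..n. \<kappa> k)"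
  using le
proof (induction n)
  case 0
  show ?case using prob_space.emeasure_space_1[OF M] by simp
next
  case (Suc n)
  let ?H = "sample_history M X"
  \<comment> \<open>\<open>G\<close> depends on the first \<open>n\<close> samples only, hence is a
    constant while the last sample is integrated out.\<close>
  define G where "G \<omega> = (\<Prod>k=1..n. \<Phi> k \<omega> (X k \<omega>))" for \<omega>
  have G [measurable]: "G \<in> borel_measurable (?H n)"
    unfolding G_def
  proof (intro borel_measurable_prod_ennreal)
    fix k assume "k \<in> {1..n}"
    then show "(\<lambda>\<omega>. \<Phi> k \<omega> (X k \<omega>)) \<in> borel_measurable (?H n)"
      using \<Phi>[of k] by (intro measurable_sample_compose) auto
  qed
  have \<Phi>' [measurable]: "(\<lambda>(\<omega>, y). \<Phi> (Suc n) \<omega> y) \<in> borel_measurable (?H n \<Otimes>\<^sub>M lborel)"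
    and q' [measurable]: "(\<lambda>(\<omega>, y). q (Suc n) \<omega> y) \<in> borel_measurable (?H n \<Otimes>\<^sub>M lborel)"
    using \<Phi>[of "Suc n"] q[of "Suc n"] by simp_all
  have sub: "subalgebra M (?H n)" by (rule subalgebra_sample_history[OF X])
  have "(\<integral>\<^sup>+\<omega>. (\<Prod>k=1..Suc n. \<Phi> k \<omega> (X k \<omega>)) \<partial>M) = (\<integral>\<^sup>+\<omega>. G \<omega> * \<Phi> (Suc n) \<omega> (X (Suc n) \<omega>) \<partial>M)"
    by (simp add: G_def mult.commute)
  also have "\<dots> = (\<integral>\<^sup>+\<omega>. (\<integral>\<^sup>+y. G \<omega> * \<Phi> (Suc n) \<omega> y * ennreal (q (Suc n) \<omega> y) \<partial>lborel) \<partial>M)"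
  proof (rule nn_integral_cond_density[OF M sub X _ q'])
    show "has_cond_density M (?H n) (X (Suc n)) (q (Suc n))" using dens[of "Suc n"] by simp
    show "(\<lambda>(\<omega>, y). G \<omega> * \<Phi> (Suc n) \<omega> y) \<in> borel_measurable (?H n \<Otimes>\<^sub>M lborel)" by measurable
  qed simp
  also have "\<dots> = (\<integral>\<^sup>+\<omega>. G \<omega> * (\<integral>\<^sup>+y. \<Phi> (Suc n) \<omega> y * ennreal (q (Suc n) \<omega> y) \<partial>lborel) \<partial>M)"
  proof (rule nn_integral_cong)
    fix \<omega> assume "\<omega> \<in> space M"
    then have sp: "\<omega> \<in> space (?H n)" by simp
    have m1: "\<Phi> (Suc n) \<omega> \<in> borel_measurable lborel"
      using measurable_Pair2[OF \<Phi>' sp] unfolding prod.case .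
    have m2: "q (Suc n) \<omega> \<in> borel_measurable lborel"
      using measurable_Pair2[OF q' sp] unfolding prod.case .
    have m3: "(\<lambda>y. \<Phi> (Suc n) \<omega> y * ennreal (q (Suc n) \<omega> y)) \<in> borel_measurable lborel"
      using m1 m2 by (intro borel_measurable_times_ennreal measurable_compose[OF m2 measurable_ennreal])
    show "(\<integral>\<^sup>+y. G \<omega> * \<Phi> (Suc n) \<omega> y * ennreal (q (Suc n) \<omega> y) \<partial>lborel)
        = G \<omega> * (\<integral>\<^sup>+y. \<Phi> (Suc n) \<omega> y * ennreal (q (Suc n) \<omega> y) \<partial>lborel)"
      unfolding mult.assoc by (rule nn_integral_cmult[OF m3])
  qed
  also have "\<dots> \<le> (\<integral>\<^sup>+\<omega>. G \<omega> * \<kappa> (Suc n) \<partial>M)"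
    by (intro nn_integral_mono mult_left_mono Suc.prems) auto
  also have "\<dots> = (\<integral>\<^sup>+\<omega>. G \<omega> \<partial>M) * \<kappa> (Suc n)"
    using measurable_from_subalg[OF sub G] by (intro nn_integral_multc) auto
  also have "\<dots> \<le> (\<Prod>k=1..n. \<kappa> k) * \<kappa> (Suc n)"
    using Suc.IH Suc.prems by (intro mult_right_mono) (auto simp: G_def)
  finally show ?case by (simp add: mult.commute)
qed

subsection \<open>Tilted moments and kernel smoothing\<close>

text \<open>For positive \<open>u\<close> the right-hand side is
  \<open>u * (v / u) powr (1 - \<eta>)\<close>, and \<open>v / u\<close> is at least
  \<open>a\<close>.\<close>

lemma powr_tilt_ge:
  fixes u v :: real
  assumes "0 \<le> u" "a * u \<le> v" "0 < a" "0 < \<eta>" "\<eta> \<le> 1"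
  shows "a powr (1 - \<eta>) * u \<le> (u / v) powr \<eta> * v"
proof (cases "u = 0")
  case False
  with assms have u: "u > 0" by simp
  then have v: "v > 0" using assms by (smt (verit) mult_pos_pos)
  have "(u / v) powr \<eta> * v = u * (v / u) powr (1 - \<eta>)"
    using u v by (simp add: powr_divide powr_diff field_simps)
  moreover have "a powr (1 - \<eta>) \<le> (v / u) powr (1 - \<eta>)"
    using u v assms by (intro powr_mono2) (auto simp: field_simps)
  ultimately show ?thesis using u by (simp add: mult.commute)
qed (use assms in simp)

text \<open>The weighted arithmetic-geometric mean inequality for
  \<open>u powr \<eta> * v powr (1 - \<eta>)\<close>. Integrated for two densities, it bounds the
  tilted mass by one.\<close>

lemma powr_tilt_le_mean:
  fixes u v :: real
  assumes "0 \<le> u" "0 \<le> v" "0 < \<eta>" "\<eta> \<le> 1"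
  shows "(u / v) powr \<eta> * v \<le> \<eta> * u + (1 - \<eta>) * v"
proof (cases "u = 0 \<or> v = 0")
  case True
  then show ?thesis using assms by auto
next
  case False
  with assms have "u > 0" "v > 0" by auto
  then have "(u / v) powr \<eta> * v = u powr \<eta> * v powr (1 - \<eta>)"
    by (simp add: powr_divide powr_diff field_simps)
  also have "\<dots> \<le> \<eta> * u + (1 - \<eta>) * v"
    using \<open>u > 0\<close> \<open>v > 0\<close> assms by (intro Youngs_inequality_0) auto
  finally show ?thesis .
qed

text \<open>The factor \<open>v powr (1 - \<eta>)\<close> is bounded through \<open>Q\<close>; the
  mean inequality for \<open>u\<close> and \<open>1\<close> handles \<open>u powr \<eta>\<close> and
  produces the additive \<open>1 - \<eta>\<close>.\<close>

lemma powr_tilt_le: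
  fixes u v :: real
  assumes "0 \<le> u" "0 \<le> v" "v \<le> Q" "0 < \<eta>" "\<eta> \<le> 1"
  shows "(u / v) powr \<eta> * v \<le> Q powr (1 - \<eta>) * (u + (1 - \<eta>))"
proof (cases "u = 0 \<or> v = 0")
  case True
  then show ?thesis using assms by auto
next
  case False
  with assms have u: "u > 0" and v: "v > 0" by auto
  then have "(u / v) powr \<eta> * v = v powr (1 - \<eta>) * u powr \<eta>"
    by (simp add: powr_divide powr_diff field_simps)
  also have "\<dots> \<le> Q powr (1 - \<eta>) * (u + (1 - \<eta>))"
  proof (rule mult_mono)
    show "v powr (1 - \<eta>) \<le> Q powr (1 - \<eta>)"
      using v assms by (intro powr_mono2) auto
    have "u powr \<eta> * 1 powr (1 - \<eta>) \<le> \<eta> * u + (1 - \<eta>) * 1"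
      using u assms by (intro Youngs_inequality_0) auto
    also have "\<dots> \<le> u + (1 - \<eta>)" using u assms by (simp add: mult_left_le_one_le)
    finally show "u powr \<eta> \<le> u + (1 - \<eta>)" by simp
  qed auto
  finally show ?thesis .
qed

section \<open>Exponential moments of bounded nonnegative functions\<close>

text \<open>The right-hand side times the quadratic Taylor minorant of \<open>exp s\<close> is a
  polynomial with constant term one and no negative coefficient, so it is at least one.\<close>

lemma exp_minus_le_quadratic:
  fixes s :: real
  assumes "0 \<le> s"
  shows "exp (- s) \<le> 1 - s + s\<^sup>2"
proof -
  have "1 \<le> (1 - s + s\<^sup>2) * (1 + s + s\<^sup>2 / 2)"
  proof -
    have "(1 - s + s\<^sup>2) * (1 + s + s\<^sup>2 / 2) = 1 + s\<^sup>2 / 2 + s ^ 3 / 2 + s ^ 4 / 2"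
      by (simp add: field_simps power2_eq_square power3_eq_cube power4_eq_xxxx)
    then show ?thesis using assms by simp
  qed
  also have "\<dots> \<le> (1 - s + s\<^sup>2) * exp s"
  proof (rule mult_left_mono)
    have "1 - s + s\<^sup>2 = (s - 1/2)\<^sup>2 + 3/4"
      by (simp add: power2_eq_square algebra_simps)
    then show "0 \<le> 1 - s + s\<^sup>2" by simp
  qed (use exp_lower_Taylor_quadratic[OF assms] in simp)
  finally show ?thesis by (simp add: exp_minus field_simps)
qed

text \<open>Since \<open>0 \<le> Z \<le> B\<close>, the square of \<open>Z\<close> is at most
  \<open>B * Z\<close>: the first moment alone controls the quadratic term. Mass at most one is the
  form in which the sampling densities are available, because a path with vanishing weights loses
  the kernel part.\<close>

lemma
  fixes q Z :: "'a \<Rightarrow> real"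
  assumes q: "integrable M q" "\<And>y. 0 \<le> q y" "(\<integral>y. q y \<partial>M) \<le> 1"
    and [measurable]: "Z \<in> borel_measurable M" and Z: "\<And>y. 0 \<le> Z y" "\<And>y. Z y \<le> B"
    and t: "0 \<le> t" "t * B \<le> 1"
  shows nn_integral_exp_le: "(\<integral>\<^sup>+y. ennreal (exp (t * Z y)) * ennreal (q y) \<partial>M)
           \<le> ennreal (exp ((t + t\<^sup>2 * B) * (\<integral>y. Z y * q y \<partial>M)))"
    and nn_integral_exp_minus_le: "(\<integral>\<^sup>+y. ennreal (exp (- (t * Z y))) * ennreal (q y) \<partial>M)
           \<le> ennreal (exp (- ((t - t\<^sup>2 * B) * (\<integral>y. Z y * q y \<partial>M))))"
proof -
  have [measurable]: "q \<in> borel_measurable M" using q by auto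
  have int: "integrable M (\<lambda>y. Z y * q y)"
  proof (rule Bochner_Integration.integrable_bound[of _ "\<lambda>y. B * q y"])
    show "AE y in M. norm (Z y * q y) \<le> norm (B * q y)"
    proof (rule AE_I2)
      fix y
      have "\<bar>Z y\<bar> \<le> \<bar>B\<bar>" using Z(1)[of y] Z(2)[of y] by linarith
      then show "norm (Z y * q y) \<le> norm (B * q y)"
        by (simp add: abs_mult mult_right_mono)
    qed
  qed (use q in auto)
  \<comment> \<open>Both bounds come from an affine majorant \<open>1 + r * Z\<close>, integrated
    and then estimated by \<open>1 + x \<le> exp x\<close>.\<close>
  have general: "(\<integral>\<^sup>+y. ennreal (E y) * ennreal (q y) \<partial>M) \<le> ennreal (exp (r * (\<integral>y. Z y * q y \<partial>M)))"
    if E: "\<And>y. 0 \<le> E y" "\<And>y. E y \<le> 1 + r * Z y" for E and r :: real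
  proof -
    have nn: "0 \<le> 1 + r * Z y" for y using E order_trans by blast
    have int': "integrable M (\<lambda>y. (1 + r * Z y) * q y)"
      using q(1) int by (simp add: distrib_right mult.assoc)
    have "(\<integral>\<^sup>+y. ennreal (E y) * ennreal (q y) \<partial>M) \<le> (\<integral>\<^sup>+y. ennreal ((1 + r * Z y) * q y) \<partial>M)"
      using E q(2) by (intro nn_integral_mono) (auto simp: ennreal_mult[symmetric] intro!: ennreal_leI mult_right_mono)
    also have "\<dots> = ennreal (\<integral>y. (1 + r * Z y) * q y \<partial>M)"
      using q(2) nn by (intro nn_integral_eq_integral[OF int']) simp
    also have "(\<integral>y. (1 + r * Z y) * q y \<partial>M) = (\<integral>y. q y \<partial>M) + r * (\<integral>y. Z y * q y \<partial>M)"
      using q int by (simp add: distrib_right mult.assoc)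
    also have "ennreal \<dots> \<le> ennreal (exp (r * (\<integral>y. Z y * q y \<partial>M)))"
      using q(3) exp_ge_add_one_self[of "r * (\<integral>y. Z y * q y \<partial>M)"] by (intro ennreal_leI) linarith
    finally show ?thesis .
  qed
  have tZ: "t * Z y \<le> 1" "(t * Z y)\<^sup>2 \<le> t\<^sup>2 * B * Z y" for y
  proof -
    show "t * Z y \<le> 1" using mult_left_mono[OF Z(2)[of y] t(1)] t(2) by linarith
    have "t\<^sup>2 * (Z y * Z y) \<le> t\<^sup>2 * (B * Z y)"
      using Z by (intro mult_left_mono mult_right_mono) auto
    then show "(t * Z y)\<^sup>2 \<le> t\<^sup>2 * B * Z y" by (simp add: power2_eq_square mult_ac)
  qed
  show "(\<integral>\<^sup>+y. ennreal (exp (t * Z y)) * ennreal (q y) \<partial>M)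
           \<le> ennreal (exp ((t + t\<^sup>2 * B) * (\<integral>y. Z y * q y \<partial>M)))"
  proof (rule general)
    fix y
    show "exp (t * Z y) \<le> 1 + (t + t\<^sup>2 * B) * Z y"
      using exp_bound[of "t * Z y"] tZ[of y] t(1) Z(1)[of y] by (simp add: distrib_right)
  qed simp
  have "(\<integral>\<^sup>+y. ennreal (exp (- (t * Z y))) * ennreal (q y) \<partial>M)
           \<le> ennreal (exp ((- (t - t\<^sup>2 * B)) * (\<integral>y. Z y * q y \<partial>M)))"
  proof (rule general)
    fix y
    show "exp (- (t * Z y)) \<le> 1 + - (t - t\<^sup>2 * B) * Z y"
      using exp_minus_le_quadratic[of "t * Z y"] tZ[of y] t(1) Z(1)[of y] by (simp add: algebra_simps)
  qed simp
  then show "(\<integral>\<^sup>+y. ennreal (exp (- (t * Z y))) * ennreal (q y) \<partial>M)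
           \<le> ennreal (exp (- ((t - t\<^sup>2 * B) * (\<integral>y. Z y * q y \<partial>M))))" by (simp only: minus_mult_left)
qed

section \<open>Kernel smoothing and its bias\<close>

lemma
  fixes g :: "'a::euclidean_space \<Rightarrow> real"
  assumes b: "b > 0" and [measurable]: "K \<in> borel_measurable borel" "g \<in> borel_measurable borel"
  shows integrable_scaled_kernel_iff: "integrable lborel (\<lambda>y. scaled_kernel K b (x - y) * g y) \<longleftrightarrow>
            integrable lborel (\<lambda>u. K u * g (x - b *\<^sub>R u))"
    and integral_scaled_kernel: "(\<integral>y. scaled_kernel K b (x - y) * g y \<partial>lborel) = (\<integral>u. K u * g (x - b *\<^sub>R u) \<partial>lborel)"
proof -
  \<comment> \<open>The substitution \<open>y = x - b u\<close>; its Jacobian cancels the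
    normalization of \<open>scaled_kernel\<close>.\<close>
  have lb: "lborel = density (distr lborel borel (\<lambda>u. x + (- b) *\<^sub>R u)) (\<lambda>_. ennreal (b ^ DIM('a)))"
    using lborel_affine[of "- b" x] b by simp
  have eq: "b ^ DIM('a) * (scaled_kernel K b (x - (x + (- b) *\<^sub>R u)) * g (x + (- b) *\<^sub>R u))
      = K u * g (x - b *\<^sub>R u)" for u
    using b by (simp add: scaled_kernel_def)
  show "integrable lborel (\<lambda>y. scaled_kernel K b (x - y) * g y) \<longleftrightarrow>
            integrable lborel (\<lambda>u. K u * g (x - b *\<^sub>R u))"
    apply (subst lb)
    apply (subst integrable_density)
    subgoal unfolding scaled_kernel_def by measurable
    subgoal by measurable
    subgoal using b by simp
    apply (subst integrable_distr_eq)
    subgoal by measurable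
    subgoal unfolding scaled_kernel_def by measurable
    unfolding real_scaleR_def eq by (rule refl)
  show "(\<integral>y. scaled_kernel K b (x - y) * g y \<partial>lborel) = (\<integral>u. K u * g (x - b *\<^sub>R u) \<partial>lborel)"
    apply (subst lb)
    apply (subst integral_density)
    subgoal unfolding scaled_kernel_def by measurable
    subgoal by measurable
    subgoal using b by simp
    apply (subst integral_distr)
    subgoal by measurable
    subgoal unfolding scaled_kernel_def by measurable
    unfolding real_scaleR_def eq by (rule refl)
qed

lemma integrable_scaled_kernel:
  fixes K :: "'a::euclidean_space \<Rightarrow> real"
  assumes "b > 0" "integrable lborel K"
  shows "integrable lborel (\<lambda>y. scaled_kernel K b (x - y))"
    and "(\<integral>y. scaled_kernel K b (x - y) \<partial>lborel) = (\<integral>u. K u \<partial>lborel)"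
proof -
  have K: "K \<in> borel_measurable borel" using assms(2) by auto
  show "integrable lborel (\<lambda>y. scaled_kernel K b (x - y))"
    using integrable_scaled_kernel_iff[OF assms(1) K, of "\<lambda>_. 1" x] assms(2) by simp
  show "(\<integral>y. scaled_kernel K b (x - y) \<partial>lborel) = (\<integral>u. K u \<partial>lborel)"
    using integral_scaled_kernel[OF assms(1) K, of "\<lambda>_. 1" x] by simp
qed

text \<open>After the substitution the bias is the integral of
  \<open>K u * (g (x - b u) - g x)\<close>, because \<open>K\<close> has mass one. The Lipschitz
  bound then leaves the first absolute moment of \<open>K\<close>.\<close>

lemma kernel_smoothing_bias:
  fixes K g :: "'a::euclidean_space \<Rightarrow> real"
  assumes b: "b > 0" and K: "has_bochner_integral lborel K 1" "\<And>u. 0 \<le> K u"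
    and K1: "integrable lborel (\<lambda>u. norm u * K u)"
    and g: "L-lipschitz_on UNIV g" and gU: "\<And>y. 0 \<le> g y" "\<And>y. g y \<le> U"
  shows "integrable lborel (\<lambda>y. scaled_kernel K b (x - y) * g y)"
    and "\<bar>(\<integral>y. scaled_kernel K b (x - y) * g y \<partial>lborel) - g x\<bar> \<le> L * b * (\<integral>u. norm u * K u \<partial>lborel)"
proof -
  have Kint: "integrable lborel K" "(\<integral>u. K u \<partial>lborel) = 1"
    using K(1) by (auto simp: has_bochner_integral_iff)
  have Km [measurable]: "K \<in> borel_measurable borel" using Kint by auto
  have gm [measurable]: "g \<in> borel_measurable borel"
    using lipschitz_on_continuous_on[OF g] by (intro borel_measurable_continuous_onI) auto
  have int: "integrable lborel (\<lambda>u. K u * g (x - b *\<^sub>R u))"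
  proof (rule Bochner_Integration.integrable_bound[of _ "\<lambda>u. U * K u"])
    show "AE u in lborel. norm (K u * g (x - b *\<^sub>R u)) \<le> norm (U * K u)"
    proof (rule AE_I2)
      fix u
      have "\<bar>g (x - b *\<^sub>R u)\<bar> \<le> \<bar>U\<bar>"
        using gU(1)[of "x - b *\<^sub>R u"] gU(2)[of "x - b *\<^sub>R u"] by linarith
      then show "norm (K u * g (x - b *\<^sub>R u)) \<le> norm (U * K u)"
        by (simp add: abs_mult mult_right_mono mult.commute[of "\<bar>K u\<bar>"])
    qed
  qed (use Kint in auto)
  then show "integrable lborel (\<lambda>y. scaled_kernel K b (x - y) * g y)"
    using integrable_scaled_kernel_iff[OF b Km gm] by simp
  have "(\<integral>y. scaled_kernel K b (x - y) * g y \<partial>lborel) - g x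
      = (\<integral>u. K u * g (x - b *\<^sub>R u) \<partial>lborel) - (\<integral>u. K u * g x \<partial>lborel)"
    using Kint by (simp add: integral_scaled_kernel[OF b Km gm])
  also have "\<dots> = (\<integral>u. K u * g (x - b *\<^sub>R u) - K u * g x \<partial>lborel)"
    using int Kint by simp
  also have "\<bar>\<dots>\<bar> \<le> (\<integral>u. \<bar>K u * g (x - b *\<^sub>R u) - K u * g x\<bar> \<partial>lborel)"
    by (rule integral_abs_bound)
  also have "\<dots> \<le> (\<integral>u. L * b * (norm u * K u) \<partial>lborel)"
  proof (rule integral_mono)
    show "integrable lborel (\<lambda>u. \<bar>K u * g (x - b *\<^sub>R u) - K u * g x\<bar>)"
      using int Kint by (intro integrable_abs) auto
    show "integrable lborel (\<lambda>u. L * b * (norm u * K u))" using K1 by simp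
    fix u
    have "\<bar>g (x - b *\<^sub>R u) - g x\<bar> \<le> L * (b * norm u)"
      using lipschitz_onD[OF g, of "x - b *\<^sub>R u" x] b by (simp add: dist_norm)
    then have "\<bar>g (x - b *\<^sub>R u) - g x\<bar> * K u \<le> L * (b * norm u) * K u"
      using K(2) by (intro mult_right_mono) auto
    moreover have "\<bar>K u * g (x - b *\<^sub>R u) - K u * g x\<bar> = \<bar>g (x - b *\<^sub>R u) - g x\<bar> * K u"
      using K(2)[of u] by (simp add: right_diff_distrib[symmetric] abs_mult mult.commute)
    ultimately show "\<bar>K u * g (x - b *\<^sub>R u) - K u * g x\<bar> \<le> L * b * (norm u * K u)"
      by (simp add: mult_ac)
  qed
  finally show "\<bar>(\<integral>y. scaled_kernel K b (x - y) * g y \<partial>lborel) - g x\<bar> \<le> L * b * (\<integral>u. norm u * K u \<partial>lborel)"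
    by simp
qed

section \<open>Tilted moments against a density\<close>

text \<open>Integrating \<open>powr_tilt_ge\<close> and \<open>powr_tilt_le\<close> against
  \<open>\<phi>\<close> encloses the tilted moment between \<open>?A * ?g\<close> and
  \<open>?B * (?g + (1 - \<eta>))\<close>; the additive term stays finite because
  \<open>\<phi>\<close> has mass one.\<close>

lemma tilted_kernel_moment:
  fixes f q \<phi> :: "'a \<Rightarrow> real"
  assumes [measurable]: "f \<in> borel_measurable M" "q \<in> borel_measurable M"
    and f: "\<And>y. 0 \<le> f y" and q: "\<And>y. 0 \<le> q y" "\<And>y. q y \<le> Q" "\<And>y. a * f y \<le> q y" and a: "a > 0"
    and \<eta>: "0 < \<eta>" "\<eta> \<le> 1"
    and \<phi>: "integrable M \<phi>" "\<And>y. 0 \<le> \<phi> y" "(\<integral>y. \<phi> y \<partial>M) = 1"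
    and f\<phi>: "integrable M (\<lambda>y. \<phi> y * f y)" "(\<integral>y. \<phi> y * f y \<partial>M) \<le> V"
  shows "\<bar>(\<integral>y. (f y / q y) powr \<eta> * \<phi> y * q y \<partial>M) - (\<integral>y. \<phi> y * f y \<partial>M)\<bar>
    \<le> (\<bar>1 - a powr (1 - \<eta>)\<bar> + \<bar>Q powr (1 - \<eta>) - 1\<bar>) * V + Q powr (1 - \<eta>) * (1 - \<eta>)"
    (is "\<bar>?I - ?g\<bar> \<le> _")
proof -
  let ?A = "a powr (1 - \<eta>)" and ?B = "Q powr (1 - \<eta>)"
  have lo: "?A * (\<phi> y * f y) \<le> (f y / q y) powr \<eta> * \<phi> y * q y" for y
    using mult_left_mono[OF powr_tilt_ge[OF f q(3) a \<eta>] \<phi>(2)] by (simp add: mult_ac)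
  have up: "(f y / q y) powr \<eta> * \<phi> y * q y \<le> ?B * (\<phi> y * f y + (1 - \<eta>) * \<phi> y)" for y
    using mult_left_mono[OF powr_tilt_le[OF f q(1) q(2) \<eta>] \<phi>(2)] by (simp add: algebra_simps)
  have [measurable]: "\<phi> \<in> borel_measurable M" using \<phi> by auto
  have iU: "integrable M (\<lambda>y. ?B * (\<phi> y * f y + (1 - \<eta>) * \<phi> y))"
    using f\<phi> \<phi> by auto
  have int: "integrable M (\<lambda>y. (f y / q y) powr \<eta> * \<phi> y * q y)"
  proof (rule Bochner_Integration.integrable_bound[OF iU])
    show "AE y in M. norm ((f y / q y) powr \<eta> * \<phi> y * q y) \<le> norm (?B * (\<phi> y * f y + (1 - \<eta>) * \<phi> y))"
      using up q(1) \<phi>(2) by (intro AE_I2) (smt (verit) mult_nonneg_nonneg powr_ge_zero real_norm_def)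
  qed measurable
  have g0: "0 \<le> ?g" using f \<phi>(2) by (intro integral_nonneg_AE) auto
  have "?A * ?g \<le> ?I"
    using integral_mono[OF _ int lo] f\<phi>(1) by simp
  moreover have "?I \<le> ?B * (?g + (1 - \<eta>))"
  proof -
    have "?I \<le> (\<integral>y. ?B * (\<phi> y * f y + (1 - \<eta>) * \<phi> y) \<partial>M)"
      by (rule integral_mono[OF int iU up])
    also have "\<dots> = ?B * (?g + (1 - \<eta>))" using f\<phi> \<phi> by simp
    finally show ?thesis .
  qed
  moreover have "\<bar>1 - ?A\<bar> * ?g \<le> \<bar>1 - ?A\<bar> * V" "\<bar>?B - 1\<bar> * ?g \<le> \<bar>?B - 1\<bar> * V"
    using f\<phi>(2) by (auto intro: mult_left_mono)
  moreover have "(1 - ?A) * ?g \<le> \<bar>1 - ?A\<bar> * ?g" "(?B - 1) * ?g \<le> \<bar>?B - 1\<bar> * ?g"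
    using g0 by (auto intro!: mult_right_mono)
  moreover have "0 \<le> \<bar>1 - ?A\<bar> * ?g" "0 \<le> \<bar>?B - 1\<bar> * ?g" "0 \<le> ?B * (1 - \<eta>)" using g0 \<eta> by auto
  ultimately show ?thesis unfolding abs_le_iff by (simp add: algebra_simps)
qed

text \<open>For the constant test function an additive \<open>1 - \<eta>\<close> need not be
  integrable, so the upper bound uses \<open>powr_tilt_le_mean\<close>, whose right-hand side has
  mass at most one.\<close>

lemma tilted_mass_moment:
  fixes f q :: "'a \<Rightarrow> real"
  assumes f: "integrable M f" "(\<integral>y. f y \<partial>M) = 1" "\<And>y. 0 \<le> f y"
    and q: "integrable M q" "(\<integral>y. q y \<partial>M) \<le> 1" "\<And>y. 0 \<le> q y" "\<And>y. a * f y \<le> q y" and a: "a > 0"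
    and \<eta>: "0 < \<eta>" "\<eta> \<le> 1"
  shows "\<bar>(\<integral>y. (f y / q y) powr \<eta> * q y \<partial>M) - 1\<bar> \<le> \<bar>1 - a powr (1 - \<eta>)\<bar>"
proof -
  have up: "(f y / q y) powr \<eta> * q y \<le> \<eta> * f y + (1 - \<eta>) * q y" for y
    by (rule powr_tilt_le_mean[OF f(3) q(3) \<eta>])
  have lo: "a powr (1 - \<eta>) * f y \<le> (f y / q y) powr \<eta> * q y" for y
    by (rule powr_tilt_ge[OF f(3) q(4) a \<eta>])
  have [measurable]: "f \<in> borel_measurable M" "q \<in> borel_measurable M" using f q by auto
  have iU: "integrable M (\<lambda>y. \<eta> * f y + (1 - \<eta>) * q y)" using f q by auto
  have int: "integrable M (\<lambda>y. (f y / q y) powr \<eta> * q y)"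
  proof (rule Bochner_Integration.integrable_bound[OF iU])
    show "AE y in M. norm ((f y / q y) powr \<eta> * q y) \<le> norm (\<eta> * f y + (1 - \<eta>) * q y)"
      using up q(3) by (intro AE_I2) (smt (verit) mult_nonneg_nonneg powr_ge_zero real_norm_def)
  qed measurable
  have "a powr (1 - \<eta>) \<le> (\<integral>y. (f y / q y) powr \<eta> * q y \<partial>M)"
    using integral_mono[OF _ int lo] f by simp
  moreover have "(\<integral>y. (f y / q y) powr \<eta> * q y \<partial>M) \<le> (\<integral>y. \<eta> * f y + (1 - \<eta>) * q y \<partial>M)"
    by (rule integral_mono[OF int iU up])
  moreover have "(\<integral>y. \<eta> * f y + (1 - \<eta>) * q y \<partial>M) \<le> 1"
    using f q \<eta> mult_left_mono[OF q(2), of "1 - \<eta>"] by simp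
  ultimately show ?thesis by linarith
qed

text \<open>Cesaro averaging: a vanishing error of the single summands gives a vanishing bias of the
  mean over all samples.\<close>

lemma tendsto_average:
  fixes e :: "nat \<Rightarrow> real"
  assumes "e \<longlonglongrightarrow> 0"
  shows "(\<lambda>n. (\<Sum>k=1..n. e k) / real n) \<longlonglongrightarrow> 0"
proof (rule LIMSEQ_I)
  fix r :: real assume r: "r > 0"
  obtain N where N: "\<And>k. k \<ge> N \<Longrightarrow> \<bar>e k\<bar> < r / 2"
    using LIMSEQ_D[OF assms, of "r / 2"] r by auto
  define C where "C = (\<Sum>k=1..N. \<bar>e k\<bar>)"
  obtain N2 :: nat where N2: "C / (r / 2) < real N2" using reals_Archimedean2 by blast
  show "\<exists>no. \<forall>n\<ge>no. norm ((\<Sum>k=1..n. e k) / real n - 0) < r"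
  proof (intro exI allI impI)
    fix n assume n: "n \<ge> max (max N N2) 1"
    have "\<bar>\<Sum>k=1..n. e k\<bar> \<le> (\<Sum>k=1..n. \<bar>e k\<bar>)" by (rule sum_abs)
    also have "\<dots> = C + (\<Sum>k=N+1..n. \<bar>e k\<bar>)"
      unfolding C_def using n sum.ub_add_nat[of 1 N "\<lambda>k. \<bar>e k\<bar>" "n - N"] by simp
    also have "\<dots> \<le> C + (\<Sum>k=N+1..n. r / 2)"
      using N by (intro add_left_mono sum_mono) (auto intro: less_imp_le)
    also have "\<dots> \<le> C + real n * (r / 2)" using r by (auto intro!: mult_right_mono)
    also have "\<dots> < real n * r"
    proof -
      have "C < (r / 2) * real N2" using N2 r by (simp add: field_simps)
      also have "\<dots> \<le> (r / 2) * real n" using n r by (intro mult_left_mono) auto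
      finally show ?thesis by (simp add: field_simps)
    qed
    finally show "norm ((\<Sum>k=1..n. e k) / real n - 0) < r"
      using n by (simp add: divide_less_eq mult.commute)
  qed
qed

subsection \<open>Exponential deviation bounds\<close>

text \<open>Markov's inequality for \<open>exp T\<close>.\<close>

lemma (in prob_space) prob_ge_exp_bound:
  assumes [measurable]: "T \<in> borel_measurable M"
    and le: "(\<integral>\<^sup>+\<omega>. ennreal (exp (T \<omega>)) \<partial>M) \<le> ennreal (exp u)"
  shows "prob {\<omega> \<in> space M. v \<le> T \<omega>} \<le> exp (u - v)"
proof -
  have "emeasure M {\<omega> \<in> space M. v \<le> T \<omega>} \<le> (\<integral>\<^sup>+\<omega>. ennreal (exp (- v)) * ennreal (exp (T \<omega>)) \<partial>M)"
  proof -
    have "emeasure M {\<omega> \<in> space M. v \<le> T \<omega>} = (\<integral>\<^sup>+\<omega>. indicator {\<omega> \<in> space M. v \<le> T \<omega>} \<omega> \<partial>M)"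
      by simp
    also have "\<dots> \<le> (\<integral>\<^sup>+\<omega>. ennreal (exp (- v)) * ennreal (exp (T \<omega>)) \<partial>M)"
      by (intro nn_integral_mono) (auto simp: ennreal_mult[symmetric] exp_add[symmetric] split: split_indicator)
    finally show ?thesis .
  qed
  also have "\<dots> = ennreal (exp (- v)) * (\<integral>\<^sup>+\<omega>. ennreal (exp (T \<omega>)) \<partial>M)"
    by (rule nn_integral_cmult) measurable
  also have "\<dots> \<le> ennreal (exp (- v)) * ennreal (exp u)"
    by (rule mult_left_mono[OF le]) simp
  also have "\<dots> = ennreal (exp (u - v))"
    by (simp add: ennreal_mult[symmetric] exp_add[symmetric])
  finally show ?thesis by (simp add: emeasure_eq_measure)
qed

text \<open>The hypotheses in pointwise form, ready for use as rules; \<open>Q0\<close> is an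
  explicit upper bound for \<open>q0\<close>.\<close>

locale safe_ais = prob_space M for M :: "'b measure" +
  fixes X :: "nat \<Rightarrow> 'b \<Rightarrow> 'a::euclidean_space"
    and f q0 K :: "'a \<Rightarrow> real"
    and lam h eta :: "nat \<Rightarrow> real"
    and c L U Q0 K_inf L_K :: real
  assumes f_density: "prob_density f" and q0_density: "prob_density q0"
    and K_nonneg: "\<And>u. 0 \<le> K u"
    and X_measurable: "\<And>k. k \<ge> 1 \<Longrightarrow> X k \<in> borel_measurable M"
    and X_cond_density: "\<And>k. k \<ge> 1 \<Longrightarrow> has_cond_density M (sample_history M X (k - 1)) (X k)
                 (\<lambda>\<omega>. ais_policy K f q0 lam h eta (\<lambda>i. X i \<omega>) (k - 1))"
    and lam_pos: "\<And>k. k \<ge> 1 \<Longrightarrow> 0 < lam k" and lam_le_1: "\<And>k. k \<ge> 1 \<Longrightarrow> lam k \<le> 1"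
    and lam_antimono: "\<And>m n. 1 \<le> m \<Longrightarrow> m \<le> n \<Longrightarrow> lam n \<le> lam m"
    and h_pos: "\<And>k. k \<ge> 1 \<Longrightarrow> 0 < h k"
    and h_antimono: "\<And>m n. 1 \<le> m \<Longrightarrow> m \<le> n \<Longrightarrow> h n \<le> h m"
    and eta_pos: "\<And>k. k \<ge> 1 \<Longrightarrow> 0 < eta k" and eta_le_1: "\<And>k. k \<ge> 1 \<Longrightarrow> eta k \<le> 1"
    and h_lim: "h \<longlonglongrightarrow> 0" and eta_lim: "eta \<longlonglongrightarrow> 1"
    and lam_rate: "(\<lambda>k. ln (real k) / (real k * lam k)) \<longlonglongrightarrow> 0"
    and h_rate: "(\<lambda>k. ln (real k) / (real k * h k ^ DIM('a) * lam k)) \<longlonglongrightarrow> 0"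
    and eta_h: "(\<lambda>k. (1 - eta k) * ln (h k)) \<longlonglongrightarrow> 0"
    and eta_lam: "(\<lambda>k. (1 - eta k) * ln (lam (k - 1))) \<longlonglongrightarrow> 0"
    and q0_le: "\<And>x. q0 x \<le> Q0" and c_pos: "c > 0" and q0_ge: "\<And>x. c * f x \<le> q0 x"
    and f_lipschitz: "L-lipschitz_on UNIV f" and f_le: "\<And>x. f x \<le> U"
    and K_integral: "has_bochner_integral lborel K 1"
    and K_moment: "integrable lborel (\<lambda>u. norm u * K u)"
    and K_le: "\<And>u. K u \<le> K_inf"
    and K_lipschitz: "L_K-lipschitz_on UNIV K"
begin

section \<open>Bounds on the sampling densities\<close>

text \<open>\<open>q n\<close> is the density of sample \<open>n + 1\<close>, which explains the
  shift \<open>q (k - 1)\<close> wherever \<open>X k\<close> is treated.\<close>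

abbreviation q :: "nat \<Rightarrow> 'b \<Rightarrow> 'a \<Rightarrow> real" where
  "q n \<omega> \<equiv> ais_policy K f q0 lam h eta (\<lambda>i. X i \<omega>) n"

abbreviation w :: "nat \<Rightarrow> 'b \<Rightarrow> real" where
  "w k \<omega> \<equiv> ais_weight K f q0 lam h eta (\<lambda>i. X i \<omega>) k powr eta k"

lemma f_measurable [measurable]: "f \<in> borel_measurable borel"
  and f_nonneg: "0 \<le> f x"
  and f_integrable: "integrable lborel f" and f_integral: "(\<integral>x. f x \<partial>lborel) = 1"
  using f_density nn_integral_eq_integrable[of f lborel 1] unfolding prob_density_def by auto

lemma q0_measurable [measurable]: "q0 \<in> borel_measurable borel"
  and q0_nonneg: "0 \<le> q0 x"
  and q0_integrable: "integrable lborel q0" and q0_integral: "(\<integral>x. q0 x \<partial>lborel) = 1"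
  using q0_density nn_integral_eq_integrable[of q0 lborel 1] unfolding prob_density_def by auto

lemma K_measurable [measurable]: "K \<in> borel_measurable borel"
  and K_integrable: "integrable lborel K" and K_integral_1: "(\<integral>u. K u \<partial>lborel) = 1"
  using K_integral by (auto simp: has_bochner_integral_iff)

lemma U_pos: "0 < U"
proof (rule ccontr)
  assume "\<not> 0 < U"
  then have "f x = 0" for x using f_nonneg[of x] f_le[of x] by linarith
  then show False using f_integral by simp
qed

lemma Q0_pos: "0 < Q0"
proof (rule ccontr)
  assume "\<not> 0 < Q0"
  then have "q0 x = 0" for x using q0_nonneg[of x] q0_le[of x] by linarith
  then show False using q0_integral by simp
qed

lemma K_inf_pos: "0 < K_inf"
proof (rule ccontr)
  assume "\<not> 0 < K_inf"
  then have "K x = 0" for x using K_nonneg[of x] K_le[of x] by linarith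
  then show False using K_integral_1 by simp
qed

lemma scaled_kernel_nonneg: "n \<ge> 1 \<Longrightarrow> 0 \<le> scaled_kernel K (h n) u"
  and scaled_kernel_le: "n \<ge> 1 \<Longrightarrow> scaled_kernel K (h n) u \<le> K_inf / h n ^ DIM('a)"
  using h_pos[of n] K_nonneg K_le by (auto simp: scaled_kernel_def intro!: divide_right_mono)

lemma normalized_weight_nonneg: "0 \<le> normalized_weight eta W n k"
  unfolding normalized_weight_def by (auto intro!: divide_nonneg_nonneg sum_nonneg)

text \<open>Only an inequality: where all unnormalized weights vanish, division by zero makes the
  sum \<open>0\<close>.\<close>

lemma sum_normalized_weight_le: "(\<Sum>k=1..n. normalized_weight eta W n k) \<le> 1"
  unfolding normalized_weight_def by (simp add: sum_divide_distrib[symmetric])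

lemma ais_estimate_nonneg: "n \<ge> 1 \<Longrightarrow> 0 \<le> ais_estimate K f q0 lam h eta x n y"
  unfolding ais_estimate_def weighted_kde_def
  by (intro sum_nonneg mult_nonneg_nonneg normalized_weight_nonneg scaled_kernel_nonneg)

lemma ais_estimate_le:
  assumes "n \<ge> 1" shows "ais_estimate K f q0 lam h eta x n y \<le> K_inf / h n ^ DIM('a)"
proof -
  have "ais_estimate K f q0 lam h eta x n y
     \<le> (\<Sum>k=1..n. normalized_weight eta (ais_weight K f q0 lam h eta x) n k * (K_inf / h n ^ DIM('a)))"
    unfolding ais_estimate_def weighted_kde_def using assms
    by (intro sum_mono mult_left_mono scaled_kernel_le normalized_weight_nonneg)
  also have "\<dots> \<le> 1 * (K_inf / h n ^ DIM('a))"
    unfolding sum_distrib_right[symmetric] using K_inf_pos h_pos[OF assms]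
    by (intro mult_right_mono sum_normalized_weight_le) auto
  finally show ?thesis by simp
qed

lemma q_nonneg: "0 \<le> q n \<omega> y"
proof (cases "n = 0")
  case False
  then show ?thesis
    using ais_estimate_nonneg[of n] lam_pos[of n] lam_le_1[of n] q0_nonneg
    by (simp add: ais_policy_mixture)
qed (simp add: ais_policy_0 q0_nonneg)

text \<open>A kernel average with total weight at most one is bounded by the maximum of the scaled
  kernel. As bandwidths decrease, \<open>h (k - 1)\<close> may be replaced by \<open>h k\<close>,
  the index paired with \<open>eta k\<close> in \<open>eta_h\<close>.\<close>

lemma q_le:
  assumes "k \<ge> 1"
  shows "q (k - 1) \<omega> y \<le> Q0 + K_inf / h k ^ DIM('a)"
proof (cases "k = 1")
  case True
  have "0 \<le> K_inf / h k ^ DIM('a)" using K_inf_pos h_pos[OF assms] by simp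
  then show ?thesis using q0_le[of y] True by (simp add: ais_policy_0)
next
  case False
  define n where "n = k - 1"
  have n: "n \<ge> 1" "n \<le> k" using False assms by (auto simp: n_def)
  have "q n \<omega> y \<le> (1 - lam n) * (K_inf / h n ^ DIM('a)) + lam n * Q0"
    using n ais_estimate_le[of n] lam_pos[of n] lam_le_1[of n] q0_le
    unfolding ais_policy_mixture[OF n(1)] by (intro add_mono mult_left_mono) auto
  also have "\<dots> \<le> 1 * (K_inf / h n ^ DIM('a)) + 1 * Q0"
    using n lam_pos[of n] lam_le_1[of n] K_inf_pos h_pos[of n] Q0_pos
    by (intro add_mono mult_right_mono) auto
  also have "K_inf / h n ^ DIM('a) \<le> K_inf / h k ^ DIM('a)"
    using h_antimono[OF n] h_pos[of k] h_pos[of n] n assms K_inf_pos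
    by (intro divide_left_mono power_mono) auto
  finally show ?thesis by (simp add: n_def)
qed

text \<open>The weight of \<open>q0\<close> in the density of the \<open>k\<close>-th sample; \<open>lam 0\<close> is unconstrained.\<close>

definition safe_fraction :: "nat \<Rightarrow> real" where
  "safe_fraction k = (if k = 1 then 1 else lam (k - 1))"

lemma safe_fraction_pos: "k \<ge> 1 \<Longrightarrow> 0 < safe_fraction k"
  and safe_fraction_ge: "1 \<le> k \<Longrightarrow> k \<le> n \<Longrightarrow> lam n \<le> safe_fraction k"
  using lam_pos[of "k - 1"] lam_le_1[of n] lam_antimono[of "k - 1" n] by (auto simp: safe_fraction_def)

text \<open>The safe component alone suffices: the kernel part of the mixture is nonnegative and
  \<open>q0\<close> dominates \<open>c * f\<close>.\<close>

lemma q_ge: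
  assumes "k \<ge> 1"
  shows "c * safe_fraction k * f y \<le> q (k - 1) \<omega> y"
proof (cases "k = 1")
  case True
  then show ?thesis using q0_ge[of y] by (simp add: ais_policy_0 safe_fraction_def)
next
  case False
  define n where "n = k - 1"
  have n: "n \<ge> 1" using False assms by (auto simp: n_def)
  have "c * lam n * f y \<le> lam n * q0 y"
    using mult_left_mono[OF q0_ge[of y], of "lam n"] lam_pos[OF n] by (simp add: mult_ac)
  also have "\<dots> \<le> q n \<omega> y"
    using n ais_estimate_nonneg[of n] lam_le_1[of n] by (simp add: ais_policy_mixture)
  finally show ?thesis using False by (simp add: n_def safe_fraction_def)
qed

lemma q_measurable [measurable]: "q n \<omega> \<in> borel_measurable borel"
proof (cases "n = 0")
  case False
  then have "q n \<omega> = (\<lambda>y. (1 - lam n) * ais_estimate K f q0 lam h eta (\<lambda>i. X i \<omega>) n y + lam n * q0 y)"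
    by (simp add: ais_policy_mixture fun_eq_iff)
  then show ?thesis by (simp add: ais_estimate_def weighted_kde_def scaled_kernel_def)
qed (simp add: ais_policy_0)

lemma q_integrable: "integrable lborel (q n \<omega>)"
  and q_integral_le: "(\<integral>y. q n \<omega> y \<partial>lborel) \<le> 1"
proof -
  have "integrable lborel (q n \<omega>) \<and> (\<integral>y. q n \<omega> y \<partial>lborel) \<le> 1"
  proof (cases "n = 0")
    case True
    then show ?thesis using q0_integrable q0_integral by (simp add: ais_policy_0)
  next
    case False
    then have n: "n \<ge> 1" by simp
    define nw where "nw k = normalized_weight eta (ais_weight K f q0 lam h eta (\<lambda>i. X i \<omega>)) n k" for k
    have q: "q n \<omega> = (\<lambda>y. (1 - lam n) * (\<Sum>k=1..n. nw k * scaled_kernel K (h n) (y - X k \<omega>)) + lam n * q0 y)"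
      using n by (simp add: ais_policy_mixture fun_eq_iff ais_estimate_def weighted_kde_def nw_def)
    \<comment> \<open>The estimate has the integration variable with a plus sign,
      \<open>K_h(y - X_k)\<close>, while \<open>integrable_scaled_kernel\<close> has it with a minus
      sign; reflecting the kernel reconciles them.\<close>
    have refl: "integrable lborel (\<lambda>u. K (- u))" "(\<integral>u. K (- u) \<partial>lborel) = 1"
    proof -
      have "(lborel :: 'a measure) = density (distr lborel borel uminus) (\<lambda>_. 1)"
        using lborel_affine[of "-1" "0 :: 'a"] by simp
      then have minus: "distr lborel borel uminus = (lborel :: 'a measure)" by (simp add: density_1)
      have "integrable (distr lborel borel uminus) K" "(\<integral>u. K u \<partial>distr lborel borel uminus) = 1"
        using K_integrable K_integral_1 by (simp_all only: minus)
      then show "integrable lborel (\<lambda>u. K (- u))" "(\<integral>u. K (- u) \<partial>lborel) = 1"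
        by (simp_all add: integrable_distr_eq integral_distr)
    qed
    have sk: "integrable lborel (\<lambda>y. scaled_kernel K (h n) (y - x))"
      "(\<integral>y. scaled_kernel K (h n) (y - x) \<partial>lborel) = 1" for x
    proof -
      have "scaled_kernel K (h n) (y - x) = scaled_kernel (\<lambda>u. K (- u)) (h n) (x - y)" for y
        by (simp add: scaled_kernel_def scaleR_diff_right)
      then show "integrable lborel (\<lambda>y. scaled_kernel K (h n) (y - x))"
        "(\<integral>y. scaled_kernel K (h n) (y - x) \<partial>lborel) = 1"
        using integrable_scaled_kernel[OF h_pos[OF n] refl(1), of x] refl(2) by simp_all
    qed
    have "(\<integral>y. q n \<omega> y \<partial>lborel) = (1 - lam n) * (\<Sum>k=1..n. nw k) + lam n"
      unfolding q using sk q0_integrable q0_integral by (simp add: Bochner_Integration.integral_sum)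
    also have "\<dots> \<le> (1 - lam n) * 1 + lam n"
      using lam_le_1[OF n] sum_normalized_weight_le by (intro add_right_mono mult_left_mono) (auto simp: nw_def)
    finally have "(\<integral>y. q n \<omega> y \<partial>lborel) \<le> 1" by simp
    moreover have "integrable lborel (q n \<omega>)"
      unfolding q using sk q0_integrable by auto
    ultimately show ?thesis by simp
  qed
  then show "integrable lborel (q n \<omega>)" "(\<integral>y. q n \<omega> y \<partial>lborel) \<le> 1" by auto
qed

section \<open>Conditional moments of the weighted samples\<close>

text \<open>
  Since \<open>f powr \<eta> * q powr (1 - \<eta>)\<close> is \<open>f\<close> times \<open>(q / f) powr (1 - \<eta>)\<close>, the lower bound on \<open>q / f\<close>
  gives the first term; for small \<open>f\<close> only \<open>f powr \<eta> \<le> f + (1 - \<eta>)\<close> is available from above.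
\<close>

definition moment_error :: "nat \<Rightarrow> real" where
  "moment_error k = (\<bar>1 - (c * safe_fraction k) powr (1 - eta k)\<bar>
       + \<bar>(Q0 + K_inf / h k ^ DIM('a)) powr (1 - eta k) - 1\<bar>) * (U + 1)
     + (Q0 + K_inf / h k ^ DIM('a)) powr (1 - eta k) * (1 - eta k)"

text \<open>The logarithm is \<open>(1 - eta k) * (ln c + ln (lam (k - 1)))\<close>, which vanishes
  by \<open>eta_lam\<close> and \<open>eta_lim\<close>.\<close>

lemma lower_tilt_tendsto: "(\<lambda>k. (c * safe_fraction k) powr (1 - eta k)) \<longlonglongrightarrow> 1"
proof -
  have "(\<lambda>k. exp ((1 - eta k) * ln c + (1 - eta k) * ln (lam (k - 1)))) \<longlonglongrightarrow> exp ((1 - 1) * ln c + 0)"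
    by (intro tendsto_intros eta_lim eta_lam)
  moreover have "\<forall>\<^sub>F k in sequentially. exp ((1 - eta k) * ln c + (1 - eta k) * ln (lam (k - 1)))
      = (c * safe_fraction k) powr (1 - eta k)"
  proof (rule eventually_sequentiallyI)
    \<comment> \<open>From \<open>k = 2\<close> on, \<open>safe_fraction k\<close> is
      \<open>lam (k - 1)\<close> with a positive index, so positivity is available.\<close>
    fix k :: nat assume k: "k \<ge> 2"
    then have "lam (k - 1) > 0" by (intro lam_pos) auto
    then show "exp ((1 - eta k) * ln c + (1 - eta k) * ln (lam (k - 1))) = (c * safe_fraction k) powr (1 - eta k)"
      using k c_pos by (simp add: powr_def safe_fraction_def ln_mult distrib_left)
  qed
  ultimately show ?thesis by (simp add: tendsto_cong)
qed

text \<open>A sandwich: the base is at least \<open>Q0\<close> and, once \<open>h k < 1\<close>, at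
  most \<open>(Q0 + K_inf) / h k ^ DIM('a)\<close>, whose logarithm is handled by
  \<open>eta_h\<close>.\<close>

lemma upper_tilt_tendsto: "(\<lambda>k. (Q0 + K_inf / h k ^ DIM('a)) powr (1 - eta k)) \<longlonglongrightarrow> 1"
proof -
  let ?b = "\<lambda>k. (Q0 + K_inf / h k ^ DIM('a)) powr (1 - eta k)"
  have l1: "(\<lambda>k. exp ((1 - eta k) * ln Q0)) \<longlonglongrightarrow> exp ((1 - 1) * ln Q0)"
    by (intro tendsto_intros eta_lim)
  have l2: "(\<lambda>k. exp ((1 - eta k) * ln (Q0 + K_inf) - real DIM('a) * ((1 - eta k) * ln (h k))))
      \<longlonglongrightarrow> exp ((1 - 1) * ln (Q0 + K_inf) - real DIM('a) * 0)"
    by (intro tendsto_intros eta_lim eta_h)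
  have ev: "\<forall>\<^sub>F k in sequentially. k \<ge> 1 \<and> h k < 1"
    using eventually_ge_at_top[of 1] order_tendstoD(2)[OF h_lim zero_less_one] by eventually_elim simp
  show ?thesis
  proof (rule tendsto_sandwich)
    show "\<forall>\<^sub>F k in sequentially. exp ((1 - eta k) * ln Q0) \<le> ?b k"
      using ev
    proof eventually_elim
      case (elim k)
      have "exp ((1 - eta k) * ln Q0) = Q0 powr (1 - eta k)" using Q0_pos by (simp add: powr_def)
      also have "\<dots> \<le> ?b k"
        using Q0_pos K_inf_pos h_pos[of k] eta_le_1[of k] elim by (intro powr_mono2) auto
      finally show ?case .
    qed
    show "\<forall>\<^sub>F k in sequentially. ?b k \<le> exp ((1 - eta k) * ln (Q0 + K_inf) - real DIM('a) * ((1 - eta k) * ln (h k)))"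
      using ev
    proof eventually_elim
      case (elim k)
      have hk: "0 < h k" using elim h_pos by simp
      have "Q0 \<le> Q0 / h k ^ DIM('a)"
        using Q0_pos hk elim by (simp add: field_simps power_le_one)
      then have "?b k \<le> ((Q0 + K_inf) / h k ^ DIM('a)) powr (1 - eta k)"
        using Q0_pos K_inf_pos hk eta_le_1[of k] elim by (intro powr_mono2) (auto simp: add_divide_distrib)
      also have "\<dots> = exp ((1 - eta k) * (ln (Q0 + K_inf) - real DIM('a) * ln (h k)))"
        using Q0_pos K_inf_pos hk by (simp add: powr_def ln_div ln_realpow)
      finally show ?case by (simp add: right_diff_distrib mult_ac)
    qed
  qed (use l1 l2 in simp_all)
qed

lemma moment_error_tendsto: "moment_error \<longlonglongrightarrow> 0"
proof -
  have "moment_error \<longlonglongrightarrow> (\<bar>1 - 1\<bar> + \<bar>1 - 1\<bar>) * (U + 1) + 1 * (1 - 1)"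
    unfolding moment_error_def
    by (intro tendsto_intros lower_tilt_tendsto upper_tilt_tendsto eta_lim)
  then show ?thesis by simp
qed

text \<open>The conditional mean of \<open>w k * \<phi> (X k)\<close> given the first
  \<open>k - 1\<close> samples, written as an integral against their sampling density.\<close>

definition weighted_moment :: "nat \<Rightarrow> ('a \<Rightarrow> real) \<Rightarrow> 'b \<Rightarrow> real" where
  "weighted_moment k \<phi> \<omega> = (\<integral>y. (f y / q (k - 1) \<omega> y) powr eta k * \<phi> y * q (k - 1) \<omega> y \<partial>lborel)"

lemma weighted_moment_mass:
  assumes "k \<ge> 1"
  shows "\<bar>weighted_moment k (\<lambda>_. 1) \<omega> - 1\<bar> \<le> moment_error k"
proof -
  let ?A = "\<bar>1 - (c * safe_fraction k) powr (1 - eta k)\<bar>"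
  have "\<bar>weighted_moment k (\<lambda>_. 1) \<omega> - 1\<bar> \<le> ?A * 1"
    unfolding weighted_moment_def
    using tilted_mass_moment[OF f_integrable f_integral f_nonneg q_integrable q_integral_le q_nonneg q_ge[OF assms] _
        eta_pos[OF assms] eta_le_1[OF assms]] safe_fraction_pos[OF assms] c_pos by simp
  \<comment> \<open>The factor \<open>U + 1\<close> in \<open>moment_error\<close>, being at least
    one, lets the same error sequence serve the total mass as well as the kernels.\<close>
  also have "\<dots> \<le> (?A + \<bar>(Q0 + K_inf / h k ^ DIM('a)) powr (1 - eta k) - 1\<bar>) * (U + 1)"
    using U_pos by (intro mult_mono) auto
  also have "\<dots> \<le> moment_error k"
    unfolding moment_error_def using eta_le_1[OF assms] by simp
  finally show ?thesis .
qed

text \<open>The convolution of \<open>f\<close> with the scaled kernel: the deterministic target of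
  the numerator of the estimate.\<close>

definition smoothed :: "nat \<Rightarrow> 'a \<Rightarrow> real" where
  "smoothed n x = (\<integral>y. scaled_kernel K (h n) (x - y) * f y \<partial>lborel)"

lemma smoothed_integrable: "n \<ge> 1 \<Longrightarrow> integrable lborel (\<lambda>y. scaled_kernel K (h n) (x - y) * f y)"
  by (rule kernel_smoothing_bias(1)[OF h_pos K_integral K_nonneg K_moment f_lipschitz f_nonneg f_le])

lemma smoothed_bias:
  "n \<ge> 1 \<Longrightarrow> \<bar>smoothed n x - f x\<bar> \<le> L * h n * (\<integral>u. norm u * K u \<partial>lborel)"
  unfolding smoothed_def
  by (rule kernel_smoothing_bias(2)[OF h_pos K_integral K_nonneg K_moment f_lipschitz f_nonneg f_le])

lemma smoothed_le:
  assumes "n \<ge> 1" shows "smoothed n x \<le> U"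
proof -
  have "smoothed n x \<le> (\<integral>y. scaled_kernel K (h n) (x - y) * U \<partial>lborel)"
    unfolding smoothed_def
    using smoothed_integrable[OF assms] integrable_scaled_kernel(1)[OF h_pos[OF assms] K_integrable]
      scaled_kernel_nonneg[OF assms] f_le
    by (intro integral_mono mult_left_mono) auto
  also have "\<dots> = U"
    using integrable_scaled_kernel[OF h_pos[OF assms] K_integrable, of x] K_integral_1 by simp
  finally show ?thesis .
qed

text \<open>The scaled kernel has mass one for every bandwidth and \<open>smoothed n x\<close> is at
  most \<open>U\<close>, so the error depends on \<open>k\<close> alone, uniformly in
  \<open>n\<close>, \<open>x\<close> and the path.\<close>

lemma weighted_moment_kernel:
  assumes n: "n \<ge> 1" and k: "k \<ge> 1"
  shows "\<bar>weighted_moment k (\<lambda>y. scaled_kernel K (h n) (x - y)) \<omega> - smoothed n x\<bar> \<le> moment_error k"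
  unfolding weighted_moment_def smoothed_def moment_error_def
proof (rule tilted_kernel_moment)
  show "integrable lborel (\<lambda>y. scaled_kernel K (h n) (x - y))"
    "(\<integral>y. scaled_kernel K (h n) (x - y) \<partial>lborel) = 1"
    using integrable_scaled_kernel[OF h_pos[OF n] K_integrable] K_integral_1 by auto
  show "(\<integral>y. scaled_kernel K (h n) (x - y) * f y \<partial>lborel) \<le> U + 1"
    using smoothed_le[OF n, of x] by (simp add: smoothed_def)
  show "0 < c * safe_fraction k" using c_pos safe_fraction_pos[OF k] by simp
qed (use n k in \<open>simp_all add: f_nonneg q_nonneg q_le[simplified] q_ge[simplified] eta_pos eta_le_1 scaled_kernel_nonneg
      smoothed_integrable\<close>)

section \<open>Chernoff bound for weighted averages\<close>

text \<open>The maximum with \<open>1\<close> keeps \<open>weight_bound / lam n\<close> at least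
  one, so that raising it to an exponent \<open>eta k \<le> 1\<close> cannot increase it.\<close>

definition weight_bound :: real where "weight_bound = max 1 (1 / c)"

lemma weight_bound_pos: "0 < weight_bound" by (simp add: weight_bound_def)

lemma weight_le:
  assumes k: "1 \<le> k" "k \<le> n"
  shows "(f y / q (k - 1) \<omega> y) powr eta k \<le> weight_bound / lam n"
proof -
  have n: "n \<ge> 1" using k by simp
  note pos = lam_pos[OF n] lam_le_1[OF n] safe_fraction_pos[OF k(1)] c_pos
  have ge1: "1 \<le> weight_bound / lam n"
    using pos by (simp add: weight_bound_def)
  have "f y / q (k - 1) \<omega> y \<le> weight_bound / lam n"
  proof (cases "q (k - 1) \<omega> y = 0")
    \<comment> \<open>Division by zero makes the ratio \<open>0\<close> here.\<close>
    case True
    then show ?thesis using ge1 by simp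
  next
    case False
    then have qpos: "q (k - 1) \<omega> y > 0" using q_nonneg[of \<omega> "k - 1" y] by linarith
    have "c * lam n * f y \<le> q (k - 1) \<omega> y"
      using q_ge[OF k(1), of y \<omega>] safe_fraction_ge[OF k] f_nonneg[of y] c_pos
      by (meson mult_left_mono mult_right_mono less_imp_le order_trans)
    then have "f y / q (k - 1) \<omega> y \<le> 1 / c / lam n"
      using qpos pos by (simp add: field_simps)
    also have "\<dots> \<le> weight_bound / lam n"
      using pos by (intro divide_right_mono) (auto simp: weight_bound_def)
    finally show ?thesis .
  qed
  then have "(f y / q (k - 1) \<omega> y) powr eta k \<le> (weight_bound / lam n) powr eta k"
    using eta_pos[OF k(1)] f_nonneg q_nonneg by (intro powr_mono2) auto
  also have "\<dots> \<le> (weight_bound / lam n) powr 1"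
    using ge1 eta_le_1[OF k(1)] by (intro powr_mono) auto
  finally show ?thesis using ge1 by simp
qed

lemma q_measurable_joint:
  "(\<lambda>(\<omega>, y). q n \<omega> y) \<in> borel_measurable (sample_history M X n \<Otimes>\<^sub>M lborel)"
  by (rule measurable_ais_policy) measurable

lemma w_measurable:
  assumes "k \<ge> 1" shows "w k \<in> borel_measurable M"
proof -
  have "(\<lambda>\<omega>. ais_weight K f q0 lam h eta (\<lambda>i. X i \<omega>) k) \<in> borel_measurable (sample_history M X k)"
    using assms by (intro measurable_ais_weight) auto
  then have "(\<lambda>\<omega>. ais_weight K f q0 lam h eta (\<lambda>i. X i \<omega>) k) \<in> borel_measurable M"
    by (rule measurable_from_subalg[rotated]) (rule subalgebra_sample_history[OF X_measurable])
  then show ?thesis by measurable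
qed

definition weighted_mean :: "nat \<Rightarrow> ('a \<Rightarrow> real) \<Rightarrow> 'b \<Rightarrow> real" where
  "weighted_mean n \<phi> \<omega> = (\<Sum>k=1..n. w k \<omega> * \<phi> (X k \<omega>)) / real n"

lemma weighted_mean_measurable:
  assumes [measurable]: "\<phi> \<in> borel_measurable borel"
  shows "weighted_mean n \<phi> \<in> borel_measurable M"
  unfolding weighted_mean_def
proof (intro borel_measurable_divide borel_measurable_sum borel_measurable_const)
  fix k assume "k \<in> {1..n}"
  then have [measurable]: "w k \<in> borel_measurable M" "X k \<in> borel_measurable M"
    using w_measurable X_measurable by auto
  show "(\<lambda>\<omega>. w k \<omega> * \<phi> (X k \<omega>)) \<in> borel_measurable M" by measurable
qed

text \<open>Chernoff bounds for both tails; the summands are at most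
  \<open>weight_bound / lam n * P\<close>. Of the margin \<open>2 * \<epsilon>\<close>, one
  \<open>\<epsilon>\<close> pays for the averaged bias and half of the other for the quadratic term;
  the last half gives the rate.\<close>

lemma weighted_mean_deviation:
  assumes \<phi>m [measurable]: "\<phi> \<in> borel_measurable borel"
    and \<phi>: "\<And>y. 0 \<le> \<phi> y" "\<And>y. \<phi> y \<le> P" and P: "P > 0"
    and mom: "\<And>k \<omega>. k \<ge> 1 \<Longrightarrow> \<bar>weighted_moment k \<phi> \<omega> - g\<bar> \<le> moment_error k"
    and V: "\<And>k. k \<ge> 1 \<Longrightarrow> g + moment_error k \<le> V" "V > 0"
    and \<epsilon>: "\<epsilon> > 0" and n: "n \<ge> 1" and avg: "(\<Sum>k=1..n. moment_error k) \<le> real n * \<epsilon>"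
  shows "prob {\<omega> \<in> space M. 2 * \<epsilon> \<le> \<bar>weighted_mean n \<phi> \<omega> - g\<bar>}
     \<le> 2 * exp (- (min 1 (\<epsilon> / (2 * V)) * \<epsilon> / (2 * weight_bound) * (real n * lam n / P)))"
proof -
  (* t = \<tau> / B makes the quadratic term of the exponent at most half of the linear gain t * n * \<epsilon> *)
  define B where "B = weight_bound / lam n * P"
  define \<tau> where "\<tau> = min 1 (\<epsilon> / (2 * V))"
  define t where "t = \<tau> / B"
  define Z where "Z k \<omega> y = (f y / q (k - 1) \<omega> y) powr eta k * \<phi> y" for k \<omega> y
  define \<Sigma> where "\<Sigma> \<omega> = (\<Sum>k=1..n. Z k \<omega> (X k \<omega>))" for \<omega>
  have B: "B > 0" using weight_bound_pos lam_pos[OF n] P by (simp add: B_def)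
  have \<tau>: "\<tau> > 0" "\<tau> \<le> 1" "\<tau> * V \<le> \<epsilon> / 2"
  proof -
    show "\<tau> > 0" "\<tau> \<le> 1" using \<epsilon> V(2) by (auto simp: \<tau>_def)
    have "\<tau> * V \<le> \<epsilon> / (2 * V) * V" using V(2) by (intro mult_right_mono) (auto simp: \<tau>_def)
    then show "\<tau> * V \<le> \<epsilon> / 2" using V(2) by simp
  qed
  have t: "t > 0" "t * B = \<tau>" "0 \<le> t" "t * B \<le> 1" "t\<^sup>2 * B = t * \<tau>"
    using \<tau> B by (auto simp: t_def power2_eq_square)
  have Z0: "0 \<le> Z k \<omega> y" for k \<omega> y using \<phi> by (simp add: Z_def)
  have ZB: "Z k \<omega> y \<le> B" if "1 \<le> k" "k \<le> n" for k \<omega> y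
    unfolding Z_def B_def using weight_le[OF that, of y \<omega>] \<phi> by (intro mult_mono) (auto intro: order_trans[OF powr_ge_zero])
  have Zm [measurable]: "Z k \<omega> \<in> borel_measurable lborel" for k \<omega>
    unfolding Z_def by measurable
  have Zj: "(\<lambda>(\<omega>, y). Z k \<omega> y) \<in> borel_measurable (sample_history M X (k - 1) \<Otimes>\<^sub>M lborel)" for k
  proof -
    note [measurable] = q_measurable_joint[of "k - 1"]
    show ?thesis unfolding Z_def by measurable
  qed
  have I: "(\<integral>y. Z k \<omega> y * q (k - 1) \<omega> y \<partial>lborel) = weighted_moment k \<phi> \<omega>" for k \<omega>
    unfolding Z_def weighted_moment_def ..
  have \<Sigma>: "\<Sigma> \<omega> = real n * weighted_mean n \<phi> \<omega>" for \<omega>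
    using n by (simp add: \<Sigma>_def weighted_mean_def Z_def ais_weight_def)
  have [measurable]: "\<Sigma> \<in> borel_measurable M"
    unfolding \<Sigma> using weighted_mean_measurable[OF \<phi>m] by measurable
  \<comment> \<open>Bounds on the conditional exponential moments that are uniform over paths
    multiply to a bound for the whole sum.\<close>
  have mgf: "(\<integral>\<^sup>+\<omega>. ennreal (exp (s * \<Sigma> \<omega>)) \<partial>M) \<le> ennreal (exp (\<Sum>k=1..n. v k))"
    if le: "\<And>k \<omega>. 1 \<le> k \<Longrightarrow> k \<le> n \<Longrightarrow>
        (\<integral>\<^sup>+y. ennreal (exp (s * Z k \<omega> y)) * ennreal (q (k - 1) \<omega> y) \<partial>lborel) \<le> ennreal (exp (v k))"
    for s v
  proof -
    have "(\<integral>\<^sup>+\<omega>. ennreal (exp (s * \<Sigma> \<omega>)) \<partial>M) = (\<integral>\<^sup>+\<omega>. (\<Prod>k=1..n. ennreal (exp (s * Z k \<omega> (X k \<omega>)))) \<partial>M)"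
      by (simp add: \<Sigma>_def sum_distrib_left exp_sum prod_ennreal)
    also have "\<dots> \<le> (\<Prod>k=1..n. ennreal (exp (v k)))"
    proof (rule nn_integral_prod_samples_le[OF prob_space_axioms X_measurable X_cond_density q_measurable_joint])
      fix k :: nat assume "k \<ge> 1"
      show "(\<lambda>(\<omega>, y). ennreal (exp (s * Z k \<omega> y))) \<in> borel_measurable (sample_history M X (k - 1) \<Otimes>\<^sub>M lborel)"
        using Zj[of k] by measurable
    qed (use le in auto)
    also have "\<dots> = ennreal (exp (\<Sum>k=1..n. v k))" by (simp add: exp_sum prod_ennreal)
    finally show ?thesis .
  qed
  have sumV: "(\<Sum>k=1..n. g + moment_error k) \<le> real n * V"
    using sum_mono[of "{1..n}" "\<lambda>k. g + moment_error k" "\<lambda>_. V"] V(1) by simp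
  have sume: "(\<Sum>k=1..n. g + moment_error k) \<le> real n * g + real n * \<epsilon>"
    using avg by (simp add: sum.distrib)
  have tt: "t * \<tau> * (\<Sum>k=1..n. g + moment_error k) \<le> t * real n * \<epsilon> / 2"
  proof -
    have "t * \<tau> * (\<Sum>k=1..n. g + moment_error k) \<le> t * \<tau> * (real n * V)"
      using sumV t \<tau> by (intro mult_left_mono) auto
    also have "\<dots> = (t * real n) * (\<tau> * V)" by simp
    also have "\<dots> \<le> (t * real n) * (\<epsilon> / 2)" using \<tau>(3) t by (intro mult_left_mono) auto
    finally show ?thesis by simp
  qed
  have rate: "- (t * real n * \<epsilon> / 2) = - (\<tau> * \<epsilon> / (2 * weight_bound) * (real n * lam n / P))"
    using lam_pos[OF n] P weight_bound_pos by (simp add: t_def B_def field_simps)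
  have up: "prob {\<omega> \<in> space M. t * (real n * (g + 2 * \<epsilon>)) \<le> t * \<Sigma> \<omega>} \<le> exp (- (t * real n * \<epsilon> / 2))"
  proof -
    have "(\<integral>\<^sup>+\<omega>. ennreal (exp (t * \<Sigma> \<omega>)) \<partial>M) \<le> ennreal (exp (\<Sum>k=1..n. (t + t\<^sup>2 * B) * (g + moment_error k)))"
    proof (rule mgf)
      fix k \<omega> assume k: "1 \<le> k" "k \<le> n"
      have "(\<integral>\<^sup>+y. ennreal (exp (t * Z k \<omega> y)) * ennreal (q (k - 1) \<omega> y) \<partial>lborel)
        \<le> ennreal (exp ((t + t\<^sup>2 * B) * weighted_moment k \<phi> \<omega>))"
        unfolding I[symmetric] by (rule nn_integral_exp_le[OF q_integrable q_nonneg q_integral_le Zm Z0 ZB[OF k] t(3,4)])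
      also have "\<dots> \<le> ennreal (exp ((t + t\<^sup>2 * B) * (g + moment_error k)))"
        using mom[OF k(1), of \<omega>] t B by (intro ennreal_leI) (auto intro!: mult_left_mono)
      finally show "(\<integral>\<^sup>+y. ennreal (exp (t * Z k \<omega> y)) * ennreal (q (k - 1) \<omega> y) \<partial>lborel)
        \<le> ennreal (exp ((t + t\<^sup>2 * B) * (g + moment_error k)))" .
    qed
    then have "prob {\<omega> \<in> space M. t * (real n * (g + 2 * \<epsilon>)) \<le> t * \<Sigma> \<omega>}
      \<le> exp ((\<Sum>k=1..n. (t + t\<^sup>2 * B) * (g + moment_error k)) - t * (real n * (g + 2 * \<epsilon>)))"
      by (intro prob_ge_exp_bound) measurable
    also have "(\<Sum>k=1..n. (t + t\<^sup>2 * B) * (g + moment_error k))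
        = t * (\<Sum>k=1..n. g + moment_error k) + t * \<tau> * (\<Sum>k=1..n. g + moment_error k)"
      unfolding t by (simp add: sum_distrib_left[symmetric] distrib_right[of t] sum.distrib)
    also have "exp (\<dots> - t * (real n * (g + 2 * \<epsilon>))) \<le> exp (- (t * real n * \<epsilon> / 2))"
      using tt mult_left_mono[OF sume t(3)] by (simp add: algebra_simps)
    finally show ?thesis .
  qed
  have lo: "prob {\<omega> \<in> space M. - (t * (real n * (g - 2 * \<epsilon>))) \<le> - t * \<Sigma> \<omega>} \<le> exp (- (t * real n * \<epsilon> / 2))"
  proof -
    have "(\<integral>\<^sup>+\<omega>. ennreal (exp (- t * \<Sigma> \<omega>)) \<partial>M)
        \<le> ennreal (exp (\<Sum>k=1..n. - (t * (g - moment_error k)) + t\<^sup>2 * B * (g + moment_error k)))"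
    proof (rule mgf)
      fix k \<omega> assume k: "1 \<le> k" "k \<le> n"
      have "(\<integral>\<^sup>+y. ennreal (exp (- t * Z k \<omega> y)) * ennreal (q (k - 1) \<omega> y) \<partial>lborel)
        \<le> ennreal (exp (- ((t - t\<^sup>2 * B) * weighted_moment k \<phi> \<omega>)))"
        unfolding I[symmetric] mult_minus_left
        by (rule nn_integral_exp_minus_le[OF q_integrable q_nonneg q_integral_le Zm Z0 ZB[OF k] t(3,4)])
      also have "\<dots> \<le> ennreal (exp (- (t * (g - moment_error k)) + t\<^sup>2 * B * (g + moment_error k)))"
      proof -
        \<comment> \<open>For the lower tail the moment is needed from below in the linear term and
          from above in the quadratic term, which enters with the opposite sign.\<close>
        have "t * (g - moment_error k) \<le> t * weighted_moment k \<phi> \<omega>"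
          using mom[OF k(1), of \<omega>] t by (intro mult_left_mono) auto
        moreover have "t\<^sup>2 * B * weighted_moment k \<phi> \<omega> \<le> t\<^sup>2 * B * (g + moment_error k)"
          using mom[OF k(1), of \<omega>] B by (intro mult_left_mono) auto
        ultimately show ?thesis by (intro ennreal_leI) (simp add: left_diff_distrib)
      qed
      finally show "(\<integral>\<^sup>+y. ennreal (exp (- t * Z k \<omega> y)) * ennreal (q (k - 1) \<omega> y) \<partial>lborel)
        \<le> ennreal (exp (- (t * (g - moment_error k)) + t\<^sup>2 * B * (g + moment_error k)))" .
    qed
    then have "prob {\<omega> \<in> space M. - (t * (real n * (g - 2 * \<epsilon>))) \<le> - t * \<Sigma> \<omega>}
      \<le> exp ((\<Sum>k=1..n. - (t * (g - moment_error k)) + t\<^sup>2 * B * (g + moment_error k)) - - (t * (real n * (g - 2 * \<epsilon>))))"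
      by (intro prob_ge_exp_bound) measurable
    also have "(\<Sum>k=1..n. - (t * (g - moment_error k)) + t\<^sup>2 * B * (g + moment_error k))
        = t * (\<Sum>k=1..n. moment_error k) - t * (real n * g) + t * \<tau> * (\<Sum>k=1..n. g + moment_error k)"
      unfolding t by (simp add: sum_distrib_left[symmetric] sum.distrib sum_subtractf sum_negf right_diff_distrib)
    also have "exp (\<dots> - - (t * (real n * (g - 2 * \<epsilon>)))) \<le> exp (- (t * real n * \<epsilon> / 2))"
      using tt mult_left_mono[OF avg t(3)] by (simp add: algebra_simps)
    finally show ?thesis .
  qed
  have "prob {\<omega> \<in> space M. 2 * \<epsilon> \<le> \<bar>weighted_mean n \<phi> \<omega> - g\<bar>}
    \<le> prob ({\<omega> \<in> space M. t * (real n * (g + 2 * \<epsilon>)) \<le> t * \<Sigma> \<omega>}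
        \<union> {\<omega> \<in> space M. - (t * (real n * (g - 2 * \<epsilon>))) \<le> - t * \<Sigma> \<omega>})"
  proof (rule finite_measure_mono)
    show "{\<omega> \<in> space M. 2 * \<epsilon> \<le> \<bar>weighted_mean n \<phi> \<omega> - g\<bar>}
      \<subseteq> {\<omega> \<in> space M. t * (real n * (g + 2 * \<epsilon>)) \<le> t * \<Sigma> \<omega>}
        \<union> {\<omega> \<in> space M. - (t * (real n * (g - 2 * \<epsilon>))) \<le> - t * \<Sigma> \<omega>}"
      using t(1) n by (auto simp: \<Sigma> abs_le_iff abs_if split: if_splits)
  qed measurable
  also have "\<dots> \<le> exp (- (t * real n * \<epsilon> / 2)) + exp (- (t * real n * \<epsilon> / 2))"
    using up lo by (intro order_trans[OF measure_Un_le] add_mono) auto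
  finally show ?thesis unfolding rate \<tau>_def by simp
qed

end

subsection \<open>Uniform convergence over a grid\<close>

text \<open>The grid consists of integer points divided by \<open>n ^ 3\<close>, and
  \<open>x\<close> is rounded down in each coordinate. Coordinates up to \<open>n ^ R\<close> need
  numerators up to \<open>N = n ^ (R + 3)\<close>, hence \<open>2 * N + 1 \<le> 3 * N\<close> values
  each.\<close>

lemma finite_grid:
  fixes n R :: nat
  assumes n: "n \<ge> 1"
  shows "\<exists>G :: 'a::euclidean_space set. finite G \<and> card G \<le> (3 * n ^ (R + 3)) ^ DIM('a) \<and>
    (\<forall>x. norm x \<le> real n ^ R \<longrightarrow> (\<exists>z\<in>G. norm (x - z) \<le> DIM('a) / real n ^ 3))"
proof -
  define N where "N = n ^ (R + 3)"
  define I where "I = {- int N..int N}"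
  define p where "p m = (\<Sum>b\<in>Basis. (of_int (m b) / real n ^ 3) *\<^sub>R b)" for m :: "'a \<Rightarrow> int"
  define G where "G = p ` (\<Pi>\<^sub>E b\<in>Basis. I)"
  have fin: "finite (\<Pi>\<^sub>E b\<in>(Basis :: 'a set). I)" by (intro finite_PiE) (auto simp: I_def)
  have "card G \<le> card (\<Pi>\<^sub>E b\<in>(Basis :: 'a set). I)" unfolding G_def by (rule card_image_le[OF fin])
  also have "\<dots> = card I ^ DIM('a)" by (simp add: card_PiE)
  also have "\<dots> \<le> (3 * N) ^ DIM('a)"
  proof (rule power_mono)
    have "1 \<le> N" using n by (simp add: N_def)
    then show "card I \<le> 3 * N" by (simp add: I_def)
  qed simp
  finally have "card G \<le> (3 * n ^ (R + 3)) ^ DIM('a)" by (simp add: N_def)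
  moreover have "\<exists>z\<in>G. norm (x - z) \<le> DIM('a) / real n ^ 3" if x: "norm x \<le> real n ^ R" for x
  proof
    define m where "m = restrict (\<lambda>b. \<lfloor>(x \<bullet> b) * real n ^ 3\<rfloor>) Basis"
    have "m b \<in> I" if b: "b \<in> Basis" for b
    proof -
      have "\<bar>x \<bullet> b\<bar> \<le> real n ^ R" using Basis_le_norm[OF b, of x] x by linarith
      then have "\<bar>(x \<bullet> b) * real n ^ 3\<bar> \<le> real n ^ R * real n ^ 3"
        by (simp add: abs_mult mult_right_mono)
      also have "\<dots> = real N" by (simp add: N_def power_add)
      finally have "- real N \<le> (x \<bullet> b) * real n ^ 3" "(x \<bullet> b) * real n ^ 3 \<le> real N" by linarith+
      then have "- int N \<le> \<lfloor>(x \<bullet> b) * real n ^ 3\<rfloor>" "\<lfloor>(x \<bullet> b) * real n ^ 3\<rfloor> \<le> int N"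
        by (simp_all add: le_floor_iff floor_le_iff)
      then show ?thesis using b by (simp add: m_def I_def)
    qed
    then show "p m \<in> G" unfolding G_def by (intro imageI) (auto simp: m_def PiE_def extensional_def)
    have "x - p m = (\<Sum>b\<in>Basis. (x \<bullet> b - of_int (m b) / real n ^ 3) *\<^sub>R b)"
      unfolding p_def by (subst (1) euclidean_representation[of x, symmetric])
        (simp add: scaleR_diff_left sum_subtractf)
    also have "norm \<dots> \<le> (\<Sum>b\<in>(Basis :: 'a set). 1 / real n ^ 3)"
    proof (rule sum_norm_le)
      fix b :: 'a assume b: "b \<in> Basis"
      have "\<bar>(x \<bullet> b) * real n ^ 3 - of_int (m b)\<bar> \<le> 1"
        using b by (simp add: m_def) linarith
      moreover have "x \<bullet> b - of_int (m b) / real n ^ 3 = ((x \<bullet> b) * real n ^ 3 - of_int (m b)) / real n ^ 3"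
        using n by (simp add: diff_divide_distrib)
      ultimately show "norm ((x \<bullet> b - of_int (m b) / real n ^ 3) *\<^sub>R b) \<le> 1 / real n ^ 3"
        using b n by (simp add: divide_right_mono)
    qed
    finally show "norm (x - p m) \<le> DIM('a) / real n ^ 3" by simp
  qed
  ultimately show ?thesis using fin by (intro exI[of _ G]) (auto simp: G_def)
qed

text \<open>The limit says that \<open>real k * a k\<close> eventually exceeds any multiple of
  \<open>ln (real k)\<close>. This is how both rate hypotheses enter the union bound.\<close>

lemma exp_le_inverse_power_eventually:
  fixes a :: "nat \<Rightarrow> real"
  assumes lim: "(\<lambda>k. ln (real k) / (real k * a k)) \<longlonglongrightarrow> 0" and a: "\<And>k. k \<ge> 1 \<Longrightarrow> 0 < a k" and "\<delta> > 0"
  shows "\<forall>\<^sub>F k in sequentially. exp (- (\<delta> * (real k * a k))) \<le> 1 / real k ^ p"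
proof -
  \<comment> \<open>Using \<open>p + 1\<close> instead of \<open>p\<close> keeps the threshold
    positive when \<open>p = 0\<close>.\<close>
  have "\<delta> / (real p + 1) > 0" using \<open>\<delta> > 0\<close> by simp
  from order_tendstoD(2)[OF lim this] eventually_ge_at_top[of 1] show ?thesis
  proof eventually_elim
    case (elim k)
    have pos: "0 < real k * a k" using a elim by simp
    have "ln (real k) \<le> \<delta> / (real p + 1) * (real k * a k)"
      using elim(1) pos by (simp add: divide_less_eq)
    then have "(real p + 1) * ln (real k) \<le> \<delta> * (real k * a k)"
      by (simp add: field_simps)
    moreover have "real p * ln (real k) \<le> (real p + 1) * ln (real k)"
      using elim by (intro mult_right_mono) auto
    ultimately have "exp (- (\<delta> * (real k * a k))) \<le> exp (- (real p * ln (real k)))" by simp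
    also have "\<dots> = 1 / real k ^ p"
      using elim by (simp add: exp_minus exp_of_nat_mult inverse_eq_divide)
    finally show ?case .
  qed
qed

section \<open>Union bound and Borel-Cantelli\<close>

context safe_ais
begin

abbreviation kernel_at :: "nat \<Rightarrow> 'a \<Rightarrow> 'a \<Rightarrow> real" where
  "kernel_at n x \<equiv> \<lambda>y. scaled_kernel K (h n) (x - y)"

lemma kernel_at_measurable [measurable]: "kernel_at n x \<in> borel_measurable borel"
  unfolding scaled_kernel_def by measurable

text \<open>One \<open>\<delta>\<close> serves both averages and all points \<open>x\<close>, which
  the union bound over growing grids requires.\<close>

lemma deviation_rate:
  assumes \<epsilon>: "\<epsilon> > 0"
  obtains \<delta> where "\<delta> > 0" and
    "\<forall>\<^sub>F n in sequentially. prob {\<omega> \<in> space M. 2 * \<epsilon> \<le> \<bar>weighted_mean n (\<lambda>_. 1) \<omega> - 1\<bar>}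
        \<le> 2 * exp (- (\<delta> * (real n * lam n)))" and
    "\<forall>\<^sub>F n in sequentially. \<forall>x. prob {\<omega> \<in> space M. 2 * \<epsilon> \<le> \<bar>weighted_mean n (kernel_at n x) \<omega> - smoothed n x\<bar>}
        \<le> 2 * exp (- (\<delta> / K_inf * (real n * (h n ^ DIM('a) * lam n))))"
proof -
  obtain E where E: "\<And>k. \<bar>moment_error k\<bar> \<le> E" "E > 0"
    using Bseq_realpow convergent_imp_Bseq[OF convergentI[OF moment_error_tendsto]] unfolding Bseq_def by auto
  \<comment> \<open>\<open>V\<close> dominates \<open>g + moment_error k\<close> both for
    \<open>g = 1\<close> and for \<open>g = smoothed n x\<close>.\<close>
  define V where "V = U + 1 + E"
  have V: "V > 0" using U_pos E by (simp add: V_def)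
  define \<delta> where "\<delta> = min 1 (\<epsilon> / (2 * V)) * \<epsilon> / (2 * weight_bound)"
  have \<delta>: "\<delta> > 0" using \<epsilon> V weight_bound_pos by (simp add: \<delta>_def)
  have ev: "\<forall>\<^sub>F n in sequentially. n \<ge> 1 \<and> (\<Sum>k=1..n. moment_error k) \<le> real n * \<epsilon>"
    using order_tendstoD(2)[OF tendsto_average[OF moment_error_tendsto] \<epsilon>] eventually_ge_at_top[of 1]
    by eventually_elim (simp add: field_simps)
  show thesis
  proof (rule that[OF \<delta>])
    show "\<forall>\<^sub>F n in sequentially. prob {\<omega> \<in> space M. 2 * \<epsilon> \<le> \<bar>weighted_mean n (\<lambda>_. 1) \<omega> - 1\<bar>}
        \<le> 2 * exp (- (\<delta> * (real n * lam n)))"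
      using ev
    proof eventually_elim
      case (elim n)
      have "1 + moment_error k \<le> V" for k using E(1)[of k] U_pos by (simp add: V_def)
      then show ?case
        using weighted_mean_deviation[of "\<lambda>_. 1" 1 1 V \<epsilon> n] weighted_moment_mass elim \<epsilon> V
        unfolding \<delta>_def by simp
    qed
    show "\<forall>\<^sub>F n in sequentially. \<forall>x. prob {\<omega> \<in> space M. 2 * \<epsilon> \<le> \<bar>weighted_mean n (kernel_at n x) \<omega> - smoothed n x\<bar>}
        \<le> 2 * exp (- (\<delta> / K_inf * (real n * (h n ^ DIM('a) * lam n))))"
      using ev
    proof eventually_elim
      case (elim n)
      then have n: "n \<ge> 1" by simp
      show ?case
      proof
        fix x
        have "smoothed n x + moment_error k \<le> V" for k
          using E(1)[of k] smoothed_le[OF n, of x] by (simp add: V_def)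
        moreover have "K_inf / h n ^ DIM('a) > 0" using K_inf_pos h_pos[OF n] by simp
        ultimately have "prob {\<omega> \<in> space M. 2 * \<epsilon> \<le> \<bar>weighted_mean n (kernel_at n x) \<omega> - smoothed n x\<bar>}
          \<le> 2 * exp (- (\<delta> * (real n * lam n / (K_inf / h n ^ DIM('a)))))"
          unfolding \<delta>_def using elim \<epsilon> V scaled_kernel_nonneg[OF n] scaled_kernel_le[OF n] weighted_moment_kernel[OF n]
          by (intro weighted_mean_deviation) auto
        also have "\<delta> * (real n * lam n / (K_inf / h n ^ DIM('a))) = \<delta> / K_inf * (real n * (h n ^ DIM('a) * lam n))"
          by (simp add: field_simps)
        finally show "prob {\<omega> \<in> space M. 2 * \<epsilon> \<le> \<bar>weighted_mean n (kernel_at n x) \<omega> - smoothed n x\<bar>}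
          \<le> 2 * exp (- (\<delta> / K_inf * (real n * (h n ^ DIM('a) * lam n))))" .
      qed
    qed
  qed
qed

text \<open>Exponentially small failure probabilities beat the polynomial number of grid points, so
  the failure events have summable probabilities and almost surely only finitely many occur.\<close>

lemma AE_eventually_grid_deviation:
  fixes G :: "nat \<Rightarrow> 'a set"
  assumes \<epsilon>: "\<epsilon> > 0" and G: "\<And>n. n \<ge> 1 \<Longrightarrow> finite (G n)" "\<And>n. n \<ge> 1 \<Longrightarrow> real (card (G n)) \<le> C * real n ^ p"
  shows "AE \<omega> in M. \<forall>\<^sub>F n in sequentially. \<bar>weighted_mean n (\<lambda>_. 1) \<omega> - 1\<bar> < 2 * \<epsilon>
     \<and> (\<forall>x\<in>G n. \<bar>weighted_mean n (kernel_at n x) \<omega> - smoothed n x\<bar> < 2 * \<epsilon>)"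
proof -
  obtain \<delta> where \<delta>: "\<delta> > 0"
    and d1: "\<forall>\<^sub>F n in sequentially. prob {\<omega> \<in> space M. 2 * \<epsilon> \<le> \<bar>weighted_mean n (\<lambda>_. 1) \<omega> - 1\<bar>}
        \<le> 2 * exp (- (\<delta> * (real n * lam n)))"
    and d2: "\<forall>\<^sub>F n in sequentially. \<forall>x. prob {\<omega> \<in> space M. 2 * \<epsilon> \<le> \<bar>weighted_mean n (kernel_at n x) \<omega> - smoothed n x\<bar>}
        \<le> 2 * exp (- (\<delta> / K_inf * (real n * (h n ^ DIM('a) * lam n))))"
    using deviation_rate[OF \<epsilon>] by blast
  define A1 where "A1 n = {\<omega> \<in> space M. 2 * \<epsilon> \<le> \<bar>weighted_mean n (\<lambda>_. 1) \<omega> - 1\<bar>}" for n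
  define A2 where "A2 n x = {\<omega> \<in> space M. 2 * \<epsilon> \<le> \<bar>weighted_mean n (kernel_at n x) \<omega> - smoothed n x\<bar>}" for n x
  \<comment> \<open>Index \<open>0\<close> is cut out because nothing is assumed about
    \<open>G 0\<close>, not even finiteness.\<close>
  define A where "A n = (if n = 0 then {} else A1 n \<union> (\<Union>x\<in>G n. A2 n x))" for n
  have A1m [measurable]: "A1 n \<in> events" for n
  proof -
    have [measurable]: "weighted_mean n (\<lambda>_. 1) \<in> borel_measurable M" by (rule weighted_mean_measurable) simp
    show ?thesis unfolding A1_def by measurable
  qed
  have A2m [measurable]: "A2 n x \<in> events" for n x
  proof -
    have [measurable]: "weighted_mean n (kernel_at n x) \<in> borel_measurable M"
      by (rule weighted_mean_measurable) measurable
    show ?thesis unfolding A2_def by measurable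
  qed
  have Am: "A n \<in> events" for n
    unfolding A_def using G(1)[of n] by (auto intro!: sets.Un sets.finite_UN)
  have e1: "\<forall>\<^sub>F n in sequentially. exp (- (\<delta> * (real n * lam n))) \<le> 1 / real n ^ 2"
    by (rule exp_le_inverse_power_eventually[OF lam_rate lam_pos \<delta>])
  \<comment> \<open>The exponent \<open>p + 2\<close> leaves a summable \<open>1 / n ^ 2\<close>
    after the sum over about \<open>n ^ p\<close> grid points.\<close>
  have e2: "\<forall>\<^sub>F n in sequentially. exp (- (\<delta> / K_inf * (real n * (h n ^ DIM('a) * lam n)))) \<le> 1 / real n ^ (p + 2)"
  proof (rule exp_le_inverse_power_eventually)
    show "(\<lambda>k. ln (real k) / (real k * (h k ^ DIM('a) * lam k))) \<longlonglongrightarrow> 0"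
      using h_rate by (simp add: mult.assoc)
    show "\<And>k. 1 \<le> k \<Longrightarrow> 0 < h k ^ DIM('a) * lam k" using h_pos lam_pos by simp
    show "0 < \<delta> / K_inf" using \<delta> K_inf_pos by simp
  qed
  have "\<forall>\<^sub>F n in sequentially. norm (prob (A n)) \<le> (2 + 2 * C) * (1 / real n ^ 2)"
    using d1 d2 e1 e2 eventually_ge_at_top[of 1]
  proof eventually_elim
    case (elim n)
    have "prob (A n) \<le> prob (A1 n) + prob (\<Union>x\<in>G n. A2 n x)"
      using elim(5) G(1)[of n] unfolding A_def by (auto intro!: measure_Un_le sets.finite_UN)
    also have "prob (\<Union>x\<in>G n. A2 n x) \<le> (\<Sum>x\<in>G n. prob (A2 n x))"
      using G(1)[OF elim(5)] by (intro finite_measure_subadditive_finite) auto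
    also have "\<dots> \<le> (\<Sum>x\<in>G n. 2 * (1 / real n ^ (p + 2)))"
    proof (rule sum_mono)
      fix x
      have "prob (A2 n x) \<le> 2 * exp (- (\<delta> / K_inf * (real n * (h n ^ DIM('a) * lam n))))"
        using elim(2) by (simp add: A2_def)
      then show "prob (A2 n x) \<le> 2 * (1 / real n ^ (p + 2))" using elim(4) by linarith
    qed
    also have "\<dots> = real (card (G n)) * (2 * (1 / real n ^ (p + 2)))" by simp
    also have "\<dots> \<le> (C * real n ^ p) * (2 * (1 / real n ^ (p + 2)))"
      by (intro mult_right_mono G(2) elim(5)) simp
    also have "\<dots> = 2 * C * (1 / real n ^ 2)" using elim(5) by (simp add: power_add power2_eq_square)
    also have "prob (A1 n) \<le> 2 * (1 / real n ^ 2)" using elim(1,3) unfolding A1_def by linarith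
    finally show ?case by (simp add: add_divide_distrib)
  qed
  then have "summable (\<lambda>n. prob (A n))"
  proof (rule summable_comparison_test_ev)
    show "summable (\<lambda>n. (2 + 2 * C) * (1 / real n ^ 2))"
      using inverse_power_summable[of 2, where 'a = real] by (intro summable_mult) (simp add: inverse_eq_divide)
  qed
  then have "AE \<omega> in M. \<forall>\<^sub>F n in sequentially. \<omega> \<in> space M - A n"
    using Am by (intro borel_cantelli_AE1) (auto simp: less_top[symmetric])
  then show ?thesis
  proof eventually_elim
    case (elim \<omega>)
    show ?case
      using elim eventually_ge_at_top[of 1]
      by eventually_elim (auto simp: A_def A1_def A2_def not_le)
  qed
qed

section \<open>From the grid to the whole ball\<close>

lemma ais_estimate_eq_ratio:
  assumes "n \<ge> 1"
  shows "ais_estimate K f q0 lam h eta (\<lambda>i. X i \<omega>) n x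
    = weighted_mean n (kernel_at n x) \<omega> / weighted_mean n (\<lambda>_. 1) \<omega>"
proof -
  have "ais_estimate K f q0 lam h eta (\<lambda>i. X i \<omega>) n x
      = (\<Sum>k=1..n. w k \<omega> * kernel_at n x (X k \<omega>)) / (\<Sum>k=1..n. w k \<omega>)"
    unfolding ais_estimate_def weighted_kde_def normalized_weight_def
    by (simp add: sum_divide_distrib[of _ _ "\<Sum>k=Suc 0..n. w k \<omega>"])
  then show ?thesis using assms by (simp add: weighted_mean_def)
qed

text \<open>The scaled kernel is Lipschitz with constant \<open>L_K / h n ^ (DIM('a) + 1)\<close>,
  one power of \<open>h n\<close> coming from the inner rescaling; averaging multiplies this by the
  mean weight.\<close>

lemma weighted_mean_kernel_lipschitz:
  assumes n: "n \<ge> 1"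
  shows "\<bar>weighted_mean n (kernel_at n x) \<omega> - weighted_mean n (kernel_at n z) \<omega>\<bar>
    \<le> weighted_mean n (\<lambda>_. 1) \<omega> * (L_K * norm (x - z) / h n ^ (DIM('a) + 1))"
proof -
  have hn: "h n > 0" using h_pos[OF n] .
  let ?c = "L_K * norm (x - z) / h n ^ (DIM('a) + 1)"
  have lip: "\<bar>kernel_at n x y - kernel_at n z y\<bar> \<le> ?c" for y
  proof -
    have "\<bar>K ((x - y) /\<^sub>R h n) - K ((z - y) /\<^sub>R h n)\<bar> \<le> L_K * norm ((x - y) /\<^sub>R h n - (z - y) /\<^sub>R h n)"
      using lipschitz_onD[OF K_lipschitz] by (simp add: dist_norm)
    also have "norm ((x - y) /\<^sub>R h n - (z - y) /\<^sub>R h n) = norm (x - z) / h n"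
      using hn by (simp add: scaleR_diff_right[symmetric] divide_inverse_commute)
    finally have "\<bar>K ((x - y) /\<^sub>R h n) - K ((z - y) /\<^sub>R h n)\<bar> / h n ^ DIM('a) \<le> L_K * (norm (x - z) / h n) / h n ^ DIM('a)"
      using hn by (intro divide_right_mono) auto
    then show ?thesis
      using hn by (simp add: scaled_kernel_def diff_divide_distrib[symmetric] mult.commute)
  qed
  have "\<bar>weighted_mean n (kernel_at n x) \<omega> - weighted_mean n (kernel_at n z) \<omega>\<bar>
      = \<bar>\<Sum>k=1..n. w k \<omega> * (kernel_at n x (X k \<omega>) - kernel_at n z (X k \<omega>))\<bar> / real n"
    by (simp add: weighted_mean_def diff_divide_distrib[symmetric] right_diff_distrib sum_subtractf)
  also have "\<dots> \<le> (\<Sum>k=1..n. w k \<omega> * ?c) / real n"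
  proof (intro divide_right_mono order_trans[OF sum_abs] sum_mono)
    fix k
    show "\<bar>w k \<omega> * (kernel_at n x (X k \<omega>) - kernel_at n z (X k \<omega>))\<bar> \<le> w k \<omega> * ?c"
      unfolding abs_mult abs_of_nonneg[OF powr_ge_zero] by (intro mult_left_mono lip) simp
  qed simp
  also have "\<dots> = weighted_mean n (\<lambda>_. 1) \<omega> * ?c"
    unfolding sum_distrib_right[symmetric] by (simp add: weighted_mean_def)
  finally show ?thesis .
qed

text \<open>By \<open>h_rate\<close>, eventually \<open>n * h n ^ DIM('a) \<ge> 1\<close>. Squaring
  gives the claim, as \<open>2 * DIM('a) \<ge> DIM('a) + 1\<close> and \<open>h n < 1\<close>. The
  kernel slope is thus of order at most \<open>n ^ 2\<close>, which a mesh of order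
  \<open>1 / n ^ 3\<close> absorbs.\<close>

lemma h_lower_bound_eventually: "\<forall>\<^sub>F n in sequentially. 1 / h n ^ (DIM('a) + 1) \<le> real n ^ 2"
  using order_tendstoD(2)[OF h_rate zero_less_one] order_tendstoD(2)[OF h_lim zero_less_one] eventually_ge_at_top[of 3]
proof eventually_elim
  case (elim n)
  have n: "n \<ge> 1" using elim(3) by simp
  note pos = h_pos[OF n] lam_pos[OF n] lam_le_1[OF n]
  \<comment> \<open>This is the reason for \<open>n \<ge> 3\<close>: the logarithm is then at least
    one.\<close>
  have "exp 1 \<le> real n" using exp_le elim(3) by linarith
  then have "1 \<le> ln (real n)" using n by (simp add: ln_ge_iff)
  also have "\<dots> \<le> real n * h n ^ DIM('a) * lam n"
    using elim(1) pos n by (simp add: divide_less_eq)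
  also have "\<dots> \<le> real n * h n ^ DIM('a) * 1" using pos by (intro mult_left_mono) auto
  finally have *: "1 \<le> real n * h n ^ DIM('a)" by simp
  have "1 \<le> (real n * h n ^ DIM('a))\<^sup>2" using * by (rule one_le_power)
  also have "\<dots> = real n ^ 2 * h n ^ (2 * DIM('a))" by (simp add: power_mult_distrib power_mult[symmetric] mult.commute)
  also have "\<dots> \<le> real n ^ 2 * h n ^ (DIM('a) + 1)"
    using pos elim(2) DIM_positive[where 'a = 'a] by (intro mult_left_mono power_decreasing) auto
  finally show ?case using pos by (simp add: divide_le_eq)
qed

lemma uniform_convergence:
  assumes r: "r > 0"
  shows "AE \<omega> in M. (\<lambda>n. SUP x\<in>{x. norm x \<le> real n powr r}.
       \<bar>ais_estimate K f q0 lam h eta (\<lambda>i. X i \<omega>) n x - f x\<bar>) \<longlonglongrightarrow> 0"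
proof -
  define R where "R = nat \<lceil>r\<rceil>"
  obtain G :: "nat \<Rightarrow> 'a set" where G: "\<And>n. n \<ge> 1 \<Longrightarrow> finite (G n)"
      "\<And>n. n \<ge> 1 \<Longrightarrow> card (G n) \<le> (3 * n ^ (R + 3)) ^ DIM('a)"
      "\<And>n x. n \<ge> 1 \<Longrightarrow> norm x \<le> real n ^ R \<Longrightarrow> \<exists>z\<in>G n. norm (x - z) \<le> DIM('a) / real n ^ 3"
    using finite_grid[where 'a = 'a and R = R] by metis
  have card: "real (card (G n)) \<le> 3 ^ DIM('a) * real n ^ ((R + 3) * DIM('a))" if "n \<ge> 1" for n
  proof -
    have "real (card (G n)) \<le> real ((3 * n ^ (R + 3)) ^ DIM('a))" using G(2)[OF that] by (simp only: of_nat_le_iff)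
    then show ?thesis by (simp add: power_mult_distrib power_mult)
  qed
  \<comment> \<open>Countably many tolerances \<open>1 / Suc m\<close> share one null set; an
    arbitrary \<open>e\<close> is compared with them afterwards, path by path.\<close>
  have "AE \<omega> in M. \<forall>m. \<forall>\<^sub>F n in sequentially. \<bar>weighted_mean n (\<lambda>_. 1) \<omega> - 1\<bar> < 2 * (1 / real (Suc m))
     \<and> (\<forall>x\<in>G n. \<bar>weighted_mean n (kernel_at n x) \<omega> - smoothed n x\<bar> < 2 * (1 / real (Suc m)))"
    unfolding AE_all_countable by (intro allI AE_eventually_grid_deviation[OF _ G(1) card]) auto
  then show ?thesis
  proof eventually_elim
    case (elim \<omega>)
    define D where "D n = (SUP x\<in>{x. norm x \<le> real n powr r}.
       \<bar>ais_estimate K f q0 lam h eta (\<lambda>i. X i \<omega>) n x - f x\<bar>)" for n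
    have "D \<longlonglongrightarrow> 0"
    proof (rule tendstoI)
      fix e :: real assume e: "e > 0"
      \<comment> \<open>The bound \<open>1 / 4\<close> keeps the denominator \<open>S\<close> at
        least \<open>1 / 2\<close>; the other one makes the final error
        \<open>\<epsilon> * (10 + 4 * U)\<close> at most \<open>e / 2\<close>.\<close>
      define \<epsilon>0 where "\<epsilon>0 = min (1 / 4) (e / (2 * (10 + 4 * U)))"
      have e0: "\<epsilon>0 > 0" using e U_pos by (simp add: \<epsilon>0_def)
      obtain m where m: "1 / real (Suc m) < \<epsilon>0" using nat_approx_posE[OF e0] by auto
      define \<epsilon> where "\<epsilon> = 1 / real (Suc m)"
      have \<epsilon>: "\<epsilon> > 0" "\<epsilon> \<le> 1 / 4" "\<epsilon> * (10 + 4 * U) \<le> e / 2"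
      proof -
        show "\<epsilon> > 0" "\<epsilon> \<le> 1 / 4" using m by (auto simp: \<epsilon>_def \<epsilon>0_def)
        have "\<epsilon> \<le> e / (2 * (10 + 4 * U))" using m by (auto simp: \<epsilon>_def \<epsilon>0_def)
        then show "\<epsilon> * (10 + 4 * U) \<le> e / 2" using U_pos by (simp add: field_simps)
      qed
      have L0: "L \<ge> 0" using f_lipschitz by (rule lipschitz_on_nonneg)
      have LK0: "L_K \<ge> 0" using K_lipschitz by (rule lipschitz_on_nonneg)
      have ev1: "\<forall>\<^sub>F n in sequentially. L * h n * (\<integral>u. norm u * K u \<partial>lborel) < \<epsilon>"
      proof -
        have "(\<lambda>n. L * h n * (\<integral>u. norm u * K u \<partial>lborel)) \<longlonglongrightarrow> L * 0 * (\<integral>u. norm u * K u \<partial>lborel)"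
          by (intro tendsto_intros h_lim)
        then show ?thesis using \<epsilon>(1) by (intro order_tendstoD(2)) auto
      qed
      \<comment> \<open>Moving to the nearest grid point costs mesh times slope, of order
        \<open>1 / n\<close>; the factor \<open>2\<close> bounds \<open>S\<close>.\<close>
      have ev2: "\<forall>\<^sub>F n in sequentially. (2 * L_K + L) * DIM('a) / real n < \<epsilon>"
        using \<epsilon>(1) by (intro order_tendstoD(2)[OF lim_const_over_n]) auto
      show "\<forall>\<^sub>F n in sequentially. dist (D n) 0 < e"
        using ev1 ev2 elim[rule_format, of m] h_lower_bound_eventually eventually_ge_at_top[of 1]
      proof eventually_elim
        case (elim n)
        then have n: "n \<ge> 1" and n1: "real n \<ge> 1" by auto
        define S where "S = weighted_mean n (\<lambda>_. 1) \<omega>"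
        have S: "\<bar>S - 1\<bar> < 2 * \<epsilon>" "S \<ge> 1 / 2" "S \<le> 2"
        proof -
          show "\<bar>S - 1\<bar> < 2 * \<epsilon>" using elim(3) unfolding S_def \<epsilon>_def by blast
          then show "S \<ge> 1 / 2" "S \<le> 2" using \<epsilon>(2) by linarith+
        qed
        have bound: "\<bar>ais_estimate K f q0 lam h eta (\<lambda>i. X i \<omega>) n x - f x\<bar> \<le> e / 2"
          if x: "norm x \<le> real n powr r" for x
        proof -
          have "real n powr r \<le> real n powr real R"
            using n1 real_nat_ceiling_ge[of r] unfolding R_def by (intro powr_mono)
          then have "norm x \<le> real n ^ R" using x n by (simp add: powr_realpow)
          then obtain z where z: "z \<in> G n" "norm (x - z) \<le> DIM('a) / real n ^ 3"
            using G(3)[OF n] by blast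
          define N where "N y = weighted_mean n (kernel_at n y) \<omega>" for y
          have "\<bar>N x - N z\<bar> \<le> S * (L_K * norm (x - z) / h n ^ (DIM('a) + 1))"
            unfolding N_def S_def by (rule weighted_mean_kernel_lipschitz[OF n])
          also have "\<dots> = S * L_K * norm (x - z) * (1 / h n ^ (DIM('a) + 1))" by simp
          also have "\<dots> \<le> 2 * L_K * (DIM('a) / real n ^ 3) * real n ^ 2"
            using S LK0 z(2) elim(4) h_pos[OF n] by (intro mult_mono) auto
          also have "\<dots> = 2 * L_K * DIM('a) / real n" using n by (simp add: power2_eq_square power3_eq_cube)
          finally have a1: "\<bar>N x - N z\<bar> \<le> 2 * L_K * DIM('a) / real n" .
          have "\<bar>f x - f z\<bar> \<le> L * norm (x - z)"
            using lipschitz_onD[OF f_lipschitz, of x z] by (simp add: dist_norm)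
          also have "\<dots> \<le> L * (DIM('a) / real n)"
          proof (intro mult_left_mono L0 order_trans[OF z(2)] divide_left_mono)
            show "real n \<le> real n ^ 3" using n1 by (intro self_le_power) auto
          qed (use n in auto)
          finally have a2: "\<bar>f x - f z\<bar> \<le> L * DIM('a) / real n" by simp
          have a12: "\<bar>N x - N z\<bar> + \<bar>f x - f z\<bar> < \<epsilon>"
            using a1 a2 elim(2) by (simp add: distrib_right add_divide_distrib)
          have a3: "\<bar>N z - smoothed n z\<bar> < 2 * \<epsilon>" using elim(3) z(1) by (simp add: N_def \<epsilon>_def)
          have a4: "\<bar>smoothed n z - f z\<bar> < \<epsilon>" using smoothed_bias[OF n, of z] elim(1) by linarith
          have Nf: "\<bar>N x - f x\<bar> \<le> 5 * \<epsilon>" using a12 a3 a4 \<epsilon>(1) by linarith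
          \<comment> \<open>The ratio error is split into the errors of numerator and denominator,
            the latter weighted by \<open>f x \<le> U\<close>; dividing by \<open>S\<close> at most
            doubles the sum.\<close>
          have "\<bar>N x / S - f x\<bar> = \<bar>(N x - f x) - f x * (S - 1)\<bar> / S"
            using S by (simp add: field_simps)
          also have "\<dots> \<le> (5 * \<epsilon> + U * (2 * \<epsilon>)) / (1 / 2)"
          proof (rule frac_le)
            have "\<bar>f x * (S - 1)\<bar> \<le> U * (2 * \<epsilon>)"
              unfolding abs_mult using f_nonneg[of x] f_le[of x] S U_pos by (intro mult_mono) auto
            then show "\<bar>(N x - f x) - f x * (S - 1)\<bar> \<le> 5 * \<epsilon> + U * (2 * \<epsilon>)" using Nf by linarith
          qed (use S U_pos \<epsilon>(1) in auto)
          also have "\<dots> = \<epsilon> * (10 + 4 * U)" by (simp add: algebra_simps)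
          also have "\<dots> \<le> e / 2" by (rule \<epsilon>(3))
          finally show ?thesis unfolding ais_estimate_eq_ratio[OF n] N_def S_def .
        qed
        \<comment> \<open>A real supremum is an upper bound only for a set bounded above; with the
          point \<open>0\<close> of the ball this gives \<open>0 \<le> D n\<close>.\<close>
        have bdd: "bdd_above ((\<lambda>x. \<bar>ais_estimate K f q0 lam h eta (\<lambda>i. X i \<omega>) n x - f x\<bar>) ` {x. norm x \<le> real n powr r})"
          using bound by (intro bdd_aboveI[of _ "e / 2"]) auto
        have "D n \<le> e / 2"
          unfolding D_def using bound by (intro cSUP_least) (auto intro: exI[of _ 0])
        moreover have "0 \<le> D n"
          unfolding D_def by (rule cSUP_upper2[OF bdd, of 0]) auto
        ultimately show ?case using e by simp
      qed
    qed
    then show ?case unfolding D_def .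
  qed
qed

end

theorem proposition3:
  fixes M :: "'b measure"
    and X :: "nat \<Rightarrow> 'b \<Rightarrow> 'a::euclidean_space"
    and f q0 K :: "'a \<Rightarrow> real"
    and lam h eta :: "nat \<Rightarrow> real"
    and c L U K_inf L_K r :: real
  assumes "prob_space M"
    and "prob_density f" and "prob_density q0"
    and "\<forall>u. 0 \<le> K u"
    and "\<forall>k\<ge>1. X k \<in> borel_measurable M"
    and "\<forall>k\<ge>1. has_cond_density M (sample_history M X (k - 1)) (X k)
                 (\<lambda>\<omega>. ais_policy K f q0 lam h eta (\<lambda>i. X i \<omega>) (k - 1))"
    and "\<forall>n\<ge>1. AE \<omega> in M.
           (\<Sum>j=1..n. ais_weight K f q0 lam h eta (\<lambda>i. X i \<omega>) j powr eta j) > 0"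
    and "\<forall>k\<ge>1. lam k \<in> {0<..1}" and "antimono_on {1..} lam" and "lam \<longlonglongrightarrow> 0"
    and "(\<lambda>k. ln (real k) / (real k * lam k)) \<longlonglongrightarrow> 0"
    and "\<forall>k\<ge>1. h k > 0" and "antimono_on {1..} h" and "h \<longlonglongrightarrow> 0"
    and "(\<lambda>k. ln (real k) / (real k * h k ^ DIM('a) * lam k)) \<longlonglongrightarrow> 0"
    and "\<forall>k\<ge>1. eta k \<in> {0<..1}" and "eta \<longlonglongrightarrow> 1"
    and "(\<lambda>k. (1 - eta k) * ln (h k)) \<longlonglongrightarrow> 0"
    and "(\<lambda>k. (1 - eta k) * ln (lam (k - 1))) \<longlonglongrightarrow> 0"
    and "bounded (range q0)" and "c > 0" and "\<forall>x. q0 x \<ge> c * f x"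
    and "L-lipschitz_on UNIV f" and "\<forall>x. f x \<le> U"
    and "has_bochner_integral lborel K 1"
    and "integrable lborel (\<lambda>u. norm u * K u)"
    and "integrable lborel (\<lambda>u. sqrt (K u))"
    and "integrable lborel (\<lambda>u. norm u * sqrt (K u))"
    and "K_inf \<ge> 0" and "\<forall>u. K u \<le> K_inf"
    and "L_K > 0" and "L_K-lipschitz_on UNIV K"
    and "r > 0"
  shows "AE \<omega> in M.
    (\<lambda>n. SUP x\<in>{x. norm x \<le> real n powr r}.
       \<bar>ais_estimate K f q0 lam h eta (\<lambda>i. X i \<omega>) n x - f x\<bar>) \<longlonglongrightarrow> 0"
proof -
  obtain Q0 where Q0: "\<And>x. q0 x \<le> Q0"
    using \<open>bounded (range q0)\<close> unfolding bounded_iff by (auto simp: abs_le_iff)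
  have antimono: "u n \<le> u m" if "antimono_on {1..} u" "1 \<le> m" "m \<le> n" for u :: "nat \<Rightarrow> real" and m n
    using monotone_onD[OF that(1), of m n] that(2,3) by simp
  interpret safe_ais M X f q0 K lam h eta c L U Q0 K_inf L_K
    using assms Q0 antimono by (intro safe_ais.intro safe_ais_axioms.intro) auto
  show ?thesis by (rule uniform_convergence[OF \<open>r > 0\<close>])
qed

end
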